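(* Let $\mathfrak{A}$ be a $C^*$-algebra and $\mathscr{X}$ a Hilbert $\mathfrak{A}$-module. Then the sequence $\left(\|\cdot\|_n^{*}:n\in\mathbb{N}\right)$ is a multi-norm based on $\mathscr{X}$, i.e. $\left((\mathscr{X}^n,\|\cdot\|_n^{*}):n\in\mathbb{N}\right)$ is a multi-normed space.
   Context: A Hilbert $\mathfrak{A}$-module is a right $\mathfrak{A}$-module with an $\mathfrak{A}$-valued inner product $\langle\cdot,\cdot\rangle$ (linear in the second variable), complete in the norm $\|x\|=\|\langle x,x\rangle\|^{1/2}$; write $|x|=\langle x,x\rangle^{1/2}$ and $\mathscr{X}_{[1]}$ for the closed unit ball of $\mathscr{X}$. For $y_1,\dots,y_n\in\mathscr{X}$ set $$\mu^*_n(y_1,\dots,y_n)=\sup_{z\in\mathscr{X}_{[1]}}\Big\|\Big(\sum_{i=1}^n|\langle y_i,z\rangle|^2\Big)^{1/2}\Big\|,$$ and for $x=(x_1,\dots,x_n)\in\mathscr{X}^n$ set $$\|x\|_n^{*}=\sup\Big\{\Big\|\sum_{i=1}^n|\langle y_i,x_i\rangle|^2\Big\|^{1/2}: y_1,\dots,y_n\in\mathscr{X},\ \mu^*_n(y_1,\dots,y_n)\le 1\Big\}.$$ A multi-norm based on a normed space $\mathcal{X}$ is a sequence $(\|\cdot\|_n:n\in\mathbb{N})$ where $\|\cdot\|_n$ is a norm on $\mathcal{X}^n$, $\|x_0\|_1=\|x_0\|$ for $x_0\in\mathcal{X}$, and for all $n$ and $x=(x_1,\dots,x_n)\in\mathcal{X}^n$: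 (A1) $\|(x_{\sigma(1)},\dots,x_{\sigma(n)})\|_n=\|x\|_n$ for every permutation $\sigma$; (A2) $\|(\alpha_1x_1,\dots,\alpha_nx_n)\|_n\le(\max_i|\alpha_i|)\|x\|_n$ for all $\alpha_i\in\mathbb{C}$; (A3) $\|(x_1,\dots,x_{n-1},0)\|_n=\|(x_1,\dots,x_{n-1})\|_{n-1}$; (A4) $\|(x_1,\dots,x_{n-1},x_{n-1})\|_n\le\|(x_1,\dots,x_{n-1})\|_{n-1}$. *)

theory Defs
  imports "HOL-Analysis.Analysis"
begin

text \<open>A C*-algebra is a (possibly non-unital) complex Banach algebra with an
involution satisfying the C*-identity. The underlying type carries the real
Banach algebra structure; the complex scalar multiplication scA and the
involution st are explicit parameters.\<close>

definition cstar_algebra ::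
  "(complex \<Rightarrow> 'a::{banach, real_normed_algebra} \<Rightarrow> 'a) \<Rightarrow> ('a \<Rightarrow> 'a) \<Rightarrow> bool" where
  "cstar_algebra scA st \<longleftrightarrow>
     (\<forall>r a. scA (complex_of_real r) a = scaleR r a) \<and>
     (\<forall>c a b. scA c (a + b) = scA c a + scA c b) \<and>
     (\<forall>c d a. scA (c + d) a = scA c a + scA d a) \<and>
     (\<forall>c d a. scA (c * d) a = scA c (scA d a)) \<and>
     (\<forall>a. scA 1 a = a) \<and>
     (\<forall>c a. norm (scA c a) = cmod c * norm a) \<and>
     (\<forall>c a b. scA c (a * b) = scA c a * b \<and> scA c (a * b) = a * scA c b) \<and>
     (\<forall>a. st (st a) = a) \<and>
     (\<forall>a b. st (a + b) = st a + st b) \<and>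
     (\<forall>a b. st (a * b) = st b * st a) \<and>
     (\<forall>c a. st (scA c a) = scA (cnj c) (st a)) \<and>
     (\<forall>a. norm (st a * a) = (norm a)\<^sup>2)"

definition cpos :: "('a::ring \<Rightarrow> 'a) \<Rightarrow> 'a \<Rightarrow> bool" where
  "cpos st a \<longleftrightarrow> (\<exists>b. a = st b * b)"

definition csqrtA :: "('a::ring \<Rightarrow> 'a) \<Rightarrow> 'a \<Rightarrow> 'a" where
  "csqrtA st a = (THE c. cpos st c \<and> c * c = a)"

definition cabsA :: "('a::ring \<Rightarrow> 'a) \<Rightarrow> 'a \<Rightarrow> 'a" where
  "cabsA st a = csqrtA st (st a * a)"

definition hnorm :: "('x \<Rightarrow> 'x \<Rightarrow> 'a::real_normed_vector) \<Rightarrow> 'x \<Rightarrow> real" where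
  "hnorm ip x = sqrt (norm (ip x x))"

definition hilbert_module ::
  "(complex \<Rightarrow> 'a::{banach, real_normed_algebra} \<Rightarrow> 'a) \<Rightarrow> ('a \<Rightarrow> 'a) \<Rightarrow>
   (complex \<Rightarrow> 'x::ab_group_add \<Rightarrow> 'x) \<Rightarrow> ('x \<Rightarrow> 'a \<Rightarrow> 'x) \<Rightarrow> ('x \<Rightarrow> 'x \<Rightarrow> 'a) \<Rightarrow> bool" where
  "hilbert_module scA st scX act ip \<longleftrightarrow>
     cstar_algebra scA st \<and>
     \<comment> \<open>complex vector space\<close>
     (\<forall>c x y. scX c (x + y) = scX c x + scX c y) \<and>
     (\<forall>c d x. scX (c + d) x = scX c x + scX d x) \<and>
     (\<forall>c d x. scX (c * d) x = scX c (scX d x)) \<and>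
     (\<forall>x. scX 1 x = x) \<and>
     \<comment> \<open>right A-module, compatible with the scalars\<close>
     (\<forall>x y a. act (x + y) a = act x a + act y a) \<and>
     (\<forall>x a b. act x (a + b) = act x a + act x b) \<and>
     (\<forall>x a b. act x (a * b) = act (act x a) b) \<and>
     (\<forall>c x a. scX c (act x a) = act (scX c x) a \<and> scX c (act x a) = act x (scA c a)) \<and>
     \<comment> \<open>A-valued inner product, linear in the second variable\<close>
     (\<forall>x y z. ip x (y + z) = ip x y + ip x z) \<and>
     (\<forall>c x y. ip x (scX c y) = scA c (ip x y)) \<and>
     (\<forall>x y a. ip x (act y a) = ip x y * a) \<and>
     (\<forall>x y. ip y x = st (ip x y)) \<and>
     (\<forall>x. cpos st (ip x x)) \<and>
     (\<forall>x. ip x x = 0 \<longrightarrow> x = 0) \<and>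
     \<comment> \<open>completeness in the norm sqrt (norm (ip x x))\<close>
     (\<forall>f::nat \<Rightarrow> 'x. (\<forall>e>0. \<exists>N. \<forall>m\<ge>N. \<forall>n\<ge>N. hnorm ip (f m - f n) < e) \<longrightarrow>
        (\<exists>l. \<forall>e>0. \<exists>N. \<forall>n\<ge>N. hnorm ip (f n - l) < e))"

text \<open>Tuples in X^n are represented as lists of length n (list index i
corresponds to the paper's index i+1).\<close>

definition mu_star ::
  "('a::{banach, real_normed_algebra} \<Rightarrow> 'a) \<Rightarrow> ('x \<Rightarrow> 'x \<Rightarrow> 'a) \<Rightarrow> 'x list \<Rightarrow> real" where
  "mu_star st ip ys = Sup {norm (csqrtA st (\<Sum>i<length ys. cabsA st (ip (ys ! i) z) * cabsA st (ip (ys ! i) z)))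
                            | z. hnorm ip z \<le> 1}"

definition star_norm_set ::
  "('a::{banach, real_normed_algebra} \<Rightarrow> 'a) \<Rightarrow> ('x \<Rightarrow> 'x \<Rightarrow> 'a) \<Rightarrow> 'x list \<Rightarrow> real set" where
  "star_norm_set st ip xs = {sqrt (norm (\<Sum>i<length xs. cabsA st (ip (ys ! i) (xs ! i)) * cabsA st (ip (ys ! i) (xs ! i))))
                              | ys. length ys = length xs \<and> mu_star st ip ys \<le> 1}"

definition star_norm ::
  "('a::{banach, real_normed_algebra} \<Rightarrow> 'a) \<Rightarrow> ('x \<Rightarrow> 'x \<Rightarrow> 'a) \<Rightarrow> nat \<Rightarrow> 'x list \<Rightarrow> real" where
  "star_norm st ip n xs = Sup (star_norm_set st ip xs)"

definition is_norm_on :: "(complex \<Rightarrow> 'x::ab_group_add \<Rightarrow> 'x) \<Rightarrow> nat \<Rightarrow> ('x list \<Rightarrow> real) \<Rightarrow> bool" where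
  "is_norm_on sc n N \<longleftrightarrow>
     (\<forall>x. length x = n \<longrightarrow> 0 \<le> N x) \<and>
     (\<forall>x. length x = n \<longrightarrow> (N x = 0 \<longleftrightarrow> x = replicate n 0)) \<and>
     (\<forall>x y. length x = n \<and> length y = n \<longrightarrow> N (map2 (+) x y) \<le> N x + N y) \<and>
     (\<forall>c x. length x = n \<longrightarrow> N (map (sc c) x) = cmod c * N x)"

definition multi_norm ::
  "(complex \<Rightarrow> 'x::ab_group_add \<Rightarrow> 'x) \<Rightarrow> ('x \<Rightarrow> real) \<Rightarrow> (nat \<Rightarrow> 'x list \<Rightarrow> real) \<Rightarrow> bool" where
  "multi_norm sc nrm N \<longleftrightarrow>
     (\<forall>n\<ge>1. is_norm_on sc n (N n)) \<and>
     (\<forall>x0. N 1 [x0] = nrm x0) \<and>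
     \<comment> \<open>(A1)\<close>
     (\<forall>n\<ge>1. \<forall>x \<sigma>. length x = n \<and> \<sigma> permutes {..<n} \<longrightarrow>
        N n (map (\<lambda>i. x ! \<sigma> i) [0..<n]) = N n x) \<and>
     \<comment> \<open>(A2)\<close>
     (\<forall>n\<ge>1. \<forall>x \<alpha>. length x = n \<and> length \<alpha> = n \<longrightarrow>
        N n (map2 sc \<alpha> x) \<le> Max (cmod ` set \<alpha>) * N n x) \<and>
     \<comment> \<open>(A3)\<close>
     (\<forall>n\<ge>1. \<forall>x. length x = n \<longrightarrow> N (Suc n) (x @ [0]) = N n x) \<and>
     \<comment> \<open>(A4)\<close>
     (\<forall>n\<ge>1. \<forall>x. length x = n \<longrightarrow> N (Suc n) (x @ [last x]) \<le> N n x)"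

end

theory Submission
  imports Defs
begin

text \<open>All square roots are removed first: \<open>|a|\<^sup>2 = a\<^sup>*a\<close> and \<open>\<parallel>s\<^sup>1\<^sup>/\<^sup>2\<parallel> = \<parallel>s\<parallel>\<^sup>1\<^sup>/\<^sup>2\<close>, so both \<open>\<mu>\<^sub>n\<^sup>*\<close> and
  the multi-norm are suprema of norms of columns in the Hilbert module \<open>\<AA>\<^sup>n\<close>. The triangle
  inequality, (A1), (A2) and (A3) then follow from the Cauchy--Schwarz inequality in \<open>\<AA>\<^sup>n\<close> and from
  monotonicity of the norm on positive elements. For (A4) two functionals \<open>y\<close>, \<open>y'\<close> evaluated at
  the same vector are merged into one by an approximate polar decomposition.

  The order theory of a possibly non-unital \<open>C\<^sup>*\<close>-algebra is obtained without spectra: \<open>\<AA>\<close> acts by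
  left multiplication inside the unital algebra of bounded operators on the Banach space \<open>\<AA>\<close>, where
  \<open>T\<close> counts as positive if \<open>\<parallel>t - T\<parallel> \<le> t\<close> for some \<open>t \<ge> 0\<close>, and square roots are limits of an
  elementary iteration.\<close>

section \<open>The algebra of bounded operators\<close>

text \<open>A separate type, so that composition becomes \<open>*\<close> and the algebra classes
  apply.\<close>

typedef (overloaded) ('a::real_normed_vector) endo = "UNIV :: ('a \<Rightarrow>\<^sub>L 'a) set"
  morphisms blinfun_of_endo Endo ..

setup_lifting type_definition_endo

lift_definition ap :: "'a::real_normed_vector endo \<Rightarrow> 'a \<Rightarrow> 'a" is blinfun_apply .

instantiation endo :: (real_normed_vector) real_normed_vector
begin

lift_definition zero_endo :: "'a endo" is 0 .
lift_definition plus_endo :: "'a endo \<Rightarrow> 'a endo \<Rightarrow> 'a endo" is plus .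
lift_definition minus_endo :: "'a endo \<Rightarrow> 'a endo \<Rightarrow> 'a endo" is minus .
lift_definition uminus_endo :: "'a endo \<Rightarrow> 'a endo" is uminus .
lift_definition scaleR_endo :: "real \<Rightarrow> 'a endo \<Rightarrow> 'a endo" is scaleR .
lift_definition norm_endo :: "'a endo \<Rightarrow> real" is norm .
definition dist_endo :: "'a endo \<Rightarrow> 'a endo \<Rightarrow> real" where "dist_endo S T = norm (S - T)"
definition sgn_endo :: "'a endo \<Rightarrow> 'a endo" where "sgn_endo T = inverse (norm T) *\<^sub>R T"
definition uniformity_endo :: "('a endo \<times> 'a endo) filter"
  where "uniformity_endo = (INF e\<in>{0<..}. principal {(S, T). dist S T < e})"
definition open_endo :: "'a endo set \<Rightarrow> bool"
  where "open_endo U \<longleftrightarrow> (\<forall>S\<in>U. eventually (\<lambda>(S', T). S' = S \<longrightarrow> T \<in> U) uniformity)"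

instance
  apply standard
  unfolding dist_endo_def sgn_endo_def uniformity_endo_def open_endo_def
  by ((rule refl | (transfer, force simp: algebra_simps norm_triangle_ineq)))+

end

text \<open>Only \<open>monoid_mult\<close> for the unit: on a zero space \<open>1 = 0\<close>,
  which \<open>real_normed_algebra_1\<close> excludes; hence also the inequality in
  \<open>norm_one_endo\<close>.\<close>

instantiation endo :: (real_normed_vector) "{real_normed_algebra, monoid_mult}"
begin

lift_definition times_endo :: "'a endo \<Rightarrow> 'a endo \<Rightarrow> 'a endo" is blinfun_compose .
lift_definition one_endo :: "'a endo" is id_blinfun .

instance
  by standard
    (transfer, auto intro: blinfun_eqI norm_blinfun_compose
      simp: blinfun.bilinear_simps)+

end

lemma endo_eqI: "(\<And>x. ap S x = ap T x) \<Longrightarrow> S = T"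
  by transfer (rule blinfun_eqI)

lemma ap_simps [simp]:
  "ap 0 x = 0" "ap 1 x = x" "ap (S + T) x = ap S x + ap T x" "ap (S - T) x = ap S x - ap T x"
  "ap (- T) x = - ap T x" "ap (r *\<^sub>R T) x = r *\<^sub>R ap T x" "ap (S * T) x = ap S (ap T x)"
  by (transfer, simp add: blinfun.bilinear_simps)+

lemma ap_linear [simp]:
  "ap T 0 = 0" "ap T (x + y) = ap T x + ap T y" "ap T (x - y) = ap T x - ap T y"
  "ap T (- x) = - ap T x" "ap T (r *\<^sub>R x) = r *\<^sub>R ap T x"
  by (transfer, simp add: blinfun.bilinear_simps)+

lemma norm_ap: "norm (ap T x) \<le> norm T * norm x"
  by transfer (rule norm_blinfun)

lemma norm_endo_bound: "0 \<le> b \<Longrightarrow> (\<And>x. norm (ap T x) \<le> b * norm x) \<Longrightarrow> norm T \<le> b"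
  by transfer (rule norm_blinfun_bound)

lemma norm_one_endo: "norm (1 :: 'a::real_normed_vector endo) \<le> 1"
  by (rule norm_endo_bound) auto

instance endo :: (banach) banach
proof
  fix X :: "nat \<Rightarrow> 'a endo"
  assume "Cauchy X"
  then have "Cauchy (\<lambda>n. blinfun_of_endo (X n))"
    unfolding Cauchy_def dist_norm by transfer
  then obtain l where "(\<lambda>n. blinfun_of_endo (X n)) \<longlonglongrightarrow> l"
    using Cauchy_convergent_iff convergent_def by blast
  then have "X \<longlonglongrightarrow> Endo l"
    unfolding LIMSEQ_def dist_norm norm_endo.rep_eq minus_endo.rep_eq
    by (simp add: Endo_inverse)
  then show "convergent X"
    by (auto simp: convergent_def)
qed

lemma bounded_linear_ap: "bounded_linear (\<lambda>T. ap T x)"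
  by (rule bounded_linear_intro[where K="norm x"]) (auto simp: norm_ap)

lift_definition Lm :: "'a::real_normed_algebra \<Rightarrow> 'a endo"
  is "\<lambda>a. Blinfun (\<lambda>x. a * x)" .

lemma ap_Lm [simp]: "ap (Lm a) x = a * x"
  by transfer (simp add: bounded_linear_Blinfun_apply bounded_linear_mult_right)

lemma Lm_simps [simp]:
  "Lm 0 = 0" "Lm (a + b) = Lm a + Lm b" "Lm (a - b) = Lm a - Lm b" "Lm (- a) = - Lm a"
  "Lm (r *\<^sub>R a) = r *\<^sub>R Lm a" "Lm (a * b) = Lm a * Lm b"
  by (auto intro!: endo_eqI simp: algebra_simps)

section \<open>The square root iteration\<close>

text \<open>Starting at \<open>0\<close> keeps the iterates for \<open>T = Lm a\<close> inside the range of \<^const>\<open>Lm\<close>, which need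
  not contain \<open>1\<close>. With \<open>z = 1 - y\<close> the step \<open>y \<mapsto> y + (T - y\<^sup>2) / 2\<close> becomes
  \<open>z \<mapsto> ((1 - T) + z\<^sup>2) / 2\<close>, whose coefficients are nonnegative.\<close>

primrec sqrt_it :: "'u::real_normed_algebra \<Rightarrow> nat \<Rightarrow> 'u" where
  "sqrt_it T 0 = 0"
| "sqrt_it T (Suc n) = sqrt_it T n + (1/2) *\<^sub>R (T - sqrt_it T n * sqrt_it T n)"

text \<open>The iterates are the same polynomial in \<open>S\<close> and in \<open>S'\<close>, so an
  intertwiner passes through them.\<close>

lemma sqrt_it_commute:
  fixes X S S' :: "'u::real_normed_algebra"
  assumes "X * S = S' * X" shows "X * sqrt_it S n = sqrt_it S' n * X"
proof (induction n)
  case (Suc n)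
  have "X * (sqrt_it S n * sqrt_it S n) = (sqrt_it S' n * sqrt_it S' n) * X"
    by (metis Suc mult.assoc)
  with Suc assms show ?case
    by (simp add: algebra_simps)
qed simp

text \<open>Scalar worst case \<open>1 - T = 1\<close> of the recursion for \<open>w\<close> below;
  it bounds both the iterates and their increments.\<close>

primrec sqrt_maj :: "nat \<Rightarrow> real" where
  "sqrt_maj 0 = 0"
| "sqrt_maj (Suc n) = (1 + (sqrt_maj n)\<^sup>2) / 2"

lemma sqrt_maj_range: "0 \<le> sqrt_maj n \<and> sqrt_maj n \<le> 1"
  by (induction n) (auto simp: power2_eq_square mult_le_one)

lemma sqrt_maj_mono: "sqrt_maj n \<le> sqrt_maj (Suc n)"
proof -
  have "0 \<le> (1 - sqrt_maj n)\<^sup>2" by simp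
  then show ?thesis by (simp add: power2_eq_square algebra_simps)
qed

lemma sqrt_maj_lim: "sqrt_maj \<longlonglongrightarrow> 1"
proof -
  have inc: "incseq sqrt_maj"
    by (rule incseq_SucI) (rule sqrt_maj_mono)
  obtain l where l: "sqrt_maj \<longlonglongrightarrow> l"
    using incseq_convergent[OF inc] sqrt_maj_range by (metis)
  have "(\<lambda>n. sqrt_maj (Suc n)) \<longlonglongrightarrow> (1 + l\<^sup>2) / 2"
    by (simp, intro tendsto_intros l) auto
  moreover have "(\<lambda>n. sqrt_maj (Suc n)) \<longlonglongrightarrow> l"
    using l by (rule LIMSEQ_Suc)
  ultimately have "(1 + l\<^sup>2) / 2 = l"
    by (rule LIMSEQ_unique)
  then have "(l - 1)\<^sup>2 = 0"
    by (simp add: power2_eq_square algebra_simps)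
  with l show ?thesis by simp
qed

text \<open>Common induction step of \<open>w_step\<close> and \<open>z_w\<close>: differences of
  commuting squares factor like \<open>(r - s) * (r + s)\<close>.\<close>

lemma norm_half_sq_diff:
  fixes u v :: "'u::{real_normed_algebra, monoid_mult}"
  assumes "u * v = v * u" "norm u \<le> r" "norm v \<le> s" "norm (u - v) \<le> r - s"
  shows "norm ((1/2) *\<^sub>R (u * u - v * v)) \<le> r\<^sup>2 / 2 - s\<^sup>2 / 2"
proof -
  have "u * u - v * v = (u - v) * (u + v)"
    using assms(1) by (simp add: algebra_simps)
  then have "norm (u * u - v * v) \<le> norm (u - v) * norm (u + v)"
    by (simp add: norm_mult_ineq)
  also have "\<dots> \<le> (r - s) * (r + s)"
  proof (rule mult_mono)
    show "norm (u + v) \<le> r + s"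
      using assms norm_triangle_ineq[of u v] by linarith
    show "0 \<le> r - s"
      using assms(4) norm_ge_zero[of "u - v"] by linarith
  qed (use assms in auto)
  finally show ?thesis
    unfolding norm_scaleR by (simp add: power2_eq_square field_simps)
qed

locale sqrt_iteration =
  fixes T :: "'u::{banach, real_normed_algebra, monoid_mult}"
  assumes T1: "norm (1 - T) \<le> 1" and one1: "norm (1 :: 'u) \<le> 1"
begin

abbreviation "z n \<equiv> 1 - sqrt_it T n"

text \<open>The same iteration started at \<open>0\<close> instead of \<open>1\<close>; unlike \<open>z\<close> it is dominated termwise by
  \<^const>\<open>sqrt_maj\<close>, hence visibly Cauchy.\<close>

primrec w :: "nat \<Rightarrow> 'u" where
  "w 0 = 0"
| "w (Suc n) = (1/2) *\<^sub>R ((1 - T) + w n * w n)"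

lemma z_Suc: "z (Suc n) = (1/2) *\<^sub>R ((1 - T) + z n * z n)"
proof -
  have "2 *\<^sub>R z (Suc n) = (1 - T) + z n * z n"
    by (simp add: algebra_simps scaleR_2)
  then show ?thesis
    by (metis scaleR_half_double scaleR_2 scaleR_right_distrib)
qed

lemma commute_w: "X * T = T * X \<Longrightarrow> X * w n = w n * X"
proof (induction n)
  case (Suc n)
  have "X * (w n * w n) = (w n * w n) * X"
    by (metis Suc mult.assoc)
  with Suc show ?case
    by (simp add: algebra_simps)
qed simp

lemma w_T: "T * w n = w n * T"
  by (rule commute_w) simp

lemma w_w: "w m * w n = w n * w m"
  by (rule commute_w) (simp add: w_T)

lemma norm_w: "norm (w n) \<le> sqrt_maj n"
proof (induction n)
  case (Suc n)
  have "norm (w n * w n) \<le> (sqrt_maj n)\<^sup>2"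
    unfolding power2_eq_square
    using Suc norm_mult_ineq[of "w n" "w n"] mult_mono[OF Suc Suc] sqrt_maj_range[of n] by simp
  with T1 norm_triangle_ineq[of "1 - T" "w n * w n"] show ?case
    by simp
qed simp

lemma norm_z: "norm (z n) \<le> 1"
proof (induction n)
  case 0
  then show ?case using one1 by simp
next
  case (Suc n)
  have "norm (z n * z n) \<le> 1"
    using norm_mult_ineq[of "z n" "z n"] mult_mono[OF Suc Suc] by simp
  with T1 norm_triangle_ineq[of "1 - T" "z n * z n"] show ?case
    unfolding z_Suc by simp
qed

lemma w_step: "norm (w (Suc n) - w n) \<le> sqrt_maj (Suc n) - sqrt_maj n"
proof (induction n)
  case 0
  then show ?case using T1 by simp
next
  case (Suc n)
  have "w (Suc (Suc n)) - w (Suc n) = (1/2) *\<^sub>R (w (Suc n) * w (Suc n) - w n * w n)"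
    by (simp del: w.simps(2) add: w.simps(2)[of "Suc n"]) (simp add: algebra_simps)
  also have "norm \<dots> \<le> (sqrt_maj (Suc n))\<^sup>2 / 2 - (sqrt_maj n)\<^sup>2 / 2"
    by (rule norm_half_sq_diff[OF w_w norm_w norm_w Suc])
  also have "\<dots> = sqrt_maj (Suc (Suc n)) - sqrt_maj (Suc n)"
    by (simp add: field_simps)
  finally show ?case .
qed

text \<open>\<open>z\<close> has the constant scalar majorant 1, a fixed point of the recursion, and
  \<open>w\<close> has \<open>sqrt_maj\<close>. The gap tends to 0, so \<open>z\<close> converges
  together with \<open>w\<close>.\<close>

lemma z_w: "norm (z n - w n) \<le> 1 - sqrt_maj n"
proof (induction n)
  case 0
  then show ?case using one1 by simp
next
  case (Suc n)
  have T: "z n * T = T * z n"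
    using sqrt_it_commute[of T T T n] by (simp add: algebra_simps)
  have "z (Suc n) - w (Suc n) = (1/2) *\<^sub>R (z n * z n - w n * w n)"
    unfolding z_Suc by (simp add: algebra_simps)
  also have "norm \<dots> \<le> 1\<^sup>2 / 2 - (sqrt_maj n)\<^sup>2 / 2"
    by (rule norm_half_sq_diff[OF commute_w[OF T] norm_z norm_w Suc])
  also have "\<dots> = 1 - sqrt_maj (Suc n)"
    by (simp add: field_simps)
  finally show ?case .
qed

lemma w_diff: "norm (w (n + k) - w n) \<le> sqrt_maj (n + k) - sqrt_maj n"
proof (induction k)
  case (Suc k)
  have "norm (w (n + Suc k) - w n) \<le> norm (w (Suc (n + k)) - w (n + k)) + norm (w (n + k) - w n)"
    using norm_triangle_ineq[of "w (Suc (n + k)) - w (n + k)" "w (n + k) - w n"] by simp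
  with Suc w_step[of "n + k"] show ?case
    by (simp del: w.simps sqrt_maj.simps)
qed simp

lemma Cauchy_w: "Cauchy w"
  unfolding Cauchy_altdef2
proof (intro allI impI)
  fix e :: real assume "e > 0"
  then obtain N where N: "\<And>n. n \<ge> N \<Longrightarrow> dist (sqrt_maj n) 1 < e"
    using sqrt_maj_lim unfolding LIMSEQ_def by blast
  have "dist (w n) (w N) < e" if "n \<ge> N" for n
  proof -
    have "norm (w n - w N) \<le> 1 - sqrt_maj N"
      using w_diff[of N "n - N"] that sqrt_maj_range[of n] by simp
    with N[of N] show ?thesis
      by (simp add: dist_norm)
  qed
  then show "\<exists>N. \<forall>n\<ge>N. dist (w n) (w N) < e" by blast
qed

lemma convergent_sqrt_it: "convergent (sqrt_it T)"
proof -
  obtain l where l: "w \<longlonglongrightarrow> l"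
    using Cauchy_w Cauchy_convergent_iff convergent_def by blast
  have "(\<lambda>n. 1 - sqrt_maj n) \<longlonglongrightarrow> 0"
    using tendsto_diff[OF tendsto_const[of 1] sqrt_maj_lim] by simp
  then have "(\<lambda>n. z n - w n) \<longlonglongrightarrow> 0"
    by (rule Lim_null_comparison[rotated]) (simp add: z_w)
  from tendsto_add[OF this l] have "z \<longlonglongrightarrow> l" by simp
  from tendsto_diff[OF tendsto_const[of 1] this] show ?thesis
    by (auto simp: convergent_def)
qed

end

definition rt :: "'u::{banach, real_normed_algebra, monoid_mult} \<Rightarrow> 'u" where
  "rt T = lim (sqrt_it T)"

lemma rt_converges:
  fixes T :: "'a::banach endo"
  assumes "norm (1 - T) \<le> 1"
  shows "sqrt_it T \<longlonglongrightarrow> rt T"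
proof -
  interpret sqrt_iteration T
    using assms norm_one_endo by unfold_locales
  show ?thesis
    using convergent_sqrt_it unfolding rt_def convergent_LIMSEQ_iff .
qed

lemma rt_intertwines:
  fixes X T T' :: "'a::banach endo"
  assumes "norm (1 - T) \<le> 1" "norm (1 - T') \<le> 1" "X * T = T' * X"
  shows "X * rt T = rt T' * X"
proof (rule LIMSEQ_unique)
  show "(\<lambda>n. X * sqrt_it T n) \<longlonglongrightarrow> X * rt T"
    by (intro tendsto_intros rt_converges assms)
  show "(\<lambda>n. X * sqrt_it T n) \<longlonglongrightarrow> rt T' * X"
    unfolding sqrt_it_commute[OF assms(3)] by (intro tendsto_intros rt_converges assms)
qed

text \<open>The limit is a fixed point of the iteration step, so the correction
  \<open>T - rt T * rt T\<close> vanishes.\<close>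

lemma rt_square:
  fixes T :: "'a::banach endo"
  assumes "norm (1 - T) \<le> 1"
  shows "rt T * rt T = T"
proof -
  note l = rt_converges[OF assms]
  have "(\<lambda>n. sqrt_it T (Suc n)) \<longlonglongrightarrow> rt T + (1/2) *\<^sub>R (T - rt T * rt T)"
    unfolding sqrt_it.simps by (intro tendsto_intros l)
  from LIMSEQ_unique[OF this LIMSEQ_Suc[OF l]] show ?thesis
    by simp
qed

lemma norm_one_minus_rt:
  fixes T :: "'a::banach endo"
  assumes "norm (1 - T) \<le> 1"
  shows "norm (1 - rt T) \<le> 1"
proof -
  interpret sqrt_iteration T
    using assms norm_one_endo by unfold_locales
  show ?thesis
    by (rule Lim_norm_ubound[OF _ tendsto_diff[OF tendsto_const rt_converges[OF assms]]])
      (auto simp: norm_z)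
qed

text \<open>Applied below to the Hermitian operators and to \<open>range Lm\<close>.\<close>

lemma rt_closed:
  fixes T :: "'a::banach endo"
  assumes "norm (1 - T) \<le> 1" "closed C" "\<And>n. sqrt_it T n \<in> C"
  shows "rt T \<in> C"
  using closed_sequentially[OF assms(2) assms(3) rt_converges[OF assms(1)]] .

section \<open>Hermitian operators on a \<open>C\<^sup>*\<close>-algebra\<close>

locale cstar =
  fixes scA :: "complex \<Rightarrow> 'a::{banach, real_normed_algebra} \<Rightarrow> 'a"
    and st :: "'a \<Rightarrow> 'a"
  assumes cstar: "cstar_algebra scA st"
begin

lemma
  shows scA_real: "scA (complex_of_real r) a = r *\<^sub>R a"
    and scA_add: "scA c (a + b) = scA c a + scA c b"
    and scA_add_left: "scA (c + d) a = scA c a + scA d a"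
    and scA_mult: "scA (c * d) a = scA c (scA d a)"
    and scA_one [simp]: "scA 1 a = a"
    and norm_scA [simp]: "norm (scA c a) = cmod c * norm a"
    and scA_mult_left': "scA c (a * b) = scA c a * b"
    and scA_mult_right': "scA c (a * b) = a * scA c b"
    and st_st [simp]: "st (st a) = a"
    and st_add [simp]: "st (a + b) = st a + st b"
    and st_mult [simp]: "st (a * b) = st b * st a"
    and st_scA [simp]: "st (scA c a) = scA (cnj c) (st a)"
    and norm_st_mult: "norm (st a * a) = (norm a)\<^sup>2"
  using cstar unfolding cstar_algebra_def by metis+

lemmas scA_scA = scA_mult[symmetric]
  and scA_mult_left = scA_mult_left'[symmetric] and scA_mult_right = scA_mult_right'[symmetric]

lemma scA_0 [simp]: "scA c 0 = 0"
  using scA_add[of c 0 0] by simp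

lemma scA_minus [simp]: "scA c (- a) = - scA c a"
  using scA_add[of c "- a" a] by (simp add: eq_neg_iff_add_eq_0)

lemma st_0 [simp]: "st 0 = 0"
  using st_add[of 0 0] by simp

lemma st_minus [simp]: "st (- a) = - st a"
  using st_add[of "- a" a] by (simp add: eq_neg_iff_add_eq_0)

lemma st_diff [simp]: "st (a - b) = st a - st b"
  using st_add[of a "- b"] by simp

lemma st_scaleR [simp]: "st (r *\<^sub>R a) = r *\<^sub>R st a"
  using st_scA[of "complex_of_real r" a] by (simp add: scA_real)

lemma st_sum [simp]: "st (sum f I) = (\<Sum>i\<in>I. st (f i))"
  by (induction I rule: infinite_finite_induct) auto

lemma norm_st [simp]: "norm (st a) = norm a"
proof -
  have *: "norm b \<le> norm (st b)" for b
  proof (cases "b = 0")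
    case False
    have "norm b * norm b \<le> norm (st b) * norm b"
      using norm_st_mult[of b] norm_mult_ineq[of "st b" b] by (simp add: power2_eq_square)
    with False show ?thesis by simp
  qed simp
  from *[of a] *[of "st a"] show ?thesis by simp
qed

lemma st_mult_eq_0 [simp]: "st a * a = 0 \<longleftrightarrow> a = 0"
  by (metis mult_zero_right norm_eq_zero norm_st_mult zero_eq_power2)

lemma st_mult_eqI:
  assumes "\<And>y. st y * u = st y * v" shows "u = v"
  using assms[of "u - v"] st_mult_eq_0[of "u - v"] by (simp add: algebra_simps)

text \<open>For the lower bound, evaluate at \<open>st a\<close> and use the C*-identity.\<close>

lemma norm_Lm [simp]: "norm (Lm a) = norm a" for a :: 'a
proof (rule antisym)
  show "norm (Lm a) \<le> norm a"
    by (rule norm_endo_bound) (auto simp: norm_mult_ineq)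
  have "norm a * norm a \<le> norm (Lm a) * norm a"
    using norm_ap[of "Lm a" "st a"] norm_st_mult[of "st a"] by (simp add: power2_eq_square)
  then show "norm a \<le> norm (Lm a)"
    by (cases "a = 0") auto
qed

lemma Lm_inject [simp]: "Lm a = Lm b \<longleftrightarrow> a = b" for a b :: 'a
  using norm_Lm[of "a - b"] by auto

text \<open>The isometry \<open>Lm\<close> carries completeness from \<open>'a\<close> to its
  range.\<close>

lemma closed_range_Lm: "closed (range (Lm :: 'a \<Rightarrow> 'a endo))"
proof (rule complete_imp_closed, rule completeI)
  fix f :: "nat \<Rightarrow> 'a endo" assume f: "\<forall>n. f n \<in> range Lm" "Cauchy f"
  define g where "g n = (SOME a. f n = Lm a)" for n
  have fg: "f n = Lm (g n)" for n
    using f(1) unfolding g_def by (metis (mono_tags, lifting) imageE someI_ex)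
  have "dist (g m) (g n) = dist (f m) (f n)" for m n
    unfolding dist_norm fg by (metis Lm_simps(3) norm_Lm)
  with f(2) have "Cauchy g" unfolding Cauchy_def by simp
  then obtain l where l: "g \<longlonglongrightarrow> l"
    using Cauchy_convergent_iff convergent_def by blast
  have "dist (f n) (Lm l) = dist (g n) l" for n
    unfolding dist_norm fg by (metis Lm_simps(3) norm_Lm)
  with l have "f \<longlonglongrightarrow> Lm l" unfolding LIMSEQ_def by simp
  then show "\<exists>l\<in>range Lm. f \<longlonglongrightarrow> l" by blast
qed

text \<open>Self-adjointness with respect to the algebra-valued inner product \<open>st y * x\<close>.\<close>

definition herm :: "'a endo \<Rightarrow> bool" where
  "herm T \<longleftrightarrow> (\<forall>x y. st y * ap T x = st (ap T y) * x)"

lemma hermD: "herm T \<Longrightarrow> st (ap T y) * x = st y * ap T x"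
  by (simp add: herm_def)

lemma herm_simps [simp]:
  "herm 0" "herm 1" "herm S \<Longrightarrow> herm T \<Longrightarrow> herm (S + T)"
  "herm S \<Longrightarrow> herm T \<Longrightarrow> herm (S - T)" "herm T \<Longrightarrow> herm (r *\<^sub>R T)" "herm T \<Longrightarrow> herm (- T)"
  by (auto simp: herm_def algebra_simps)

lemma herm_mult: "herm S \<Longrightarrow> herm T \<Longrightarrow> S * T = T * S \<Longrightarrow> herm (S * T)"
  unfolding herm_def by (metis ap_simps(7))

lemma herm_Lm [simp]: "herm (Lm a) \<longleftrightarrow> st a = a"
proof
  assume "herm (Lm a)"
  then have "st y * (a * x) = st y * (st a * x)" for x y
    by (simp add: herm_def mult.assoc)
  then have "a * x = st a * x" for x by (rule st_mult_eqI)
  then have "Lm a = Lm (st a)" by (intro endo_eqI) simp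
  then show "st a = a" by simp
qed (simp add: herm_def mult.assoc)

text \<open>Move \<open>T\<close> to the left factor, reassociate, and move it back: operators with
  an adjoint are right module maps.\<close>

lemma herm_right: "herm T \<Longrightarrow> ap T (x * a) = ap T x * a"
  by (rule st_mult_eqI) (simp add: hermD[symmetric] mult.assoc[symmetric])

lemma herm_Lm_right: "herm T \<Longrightarrow> T * Lm a = Lm (ap T a)"
  by (rule endo_eqI) (simp add: herm_right)

lemma closed_herm: "closed {T. herm T}"
  unfolding closed_sequential_limits
proof safe
  fix f l assume f: "\<forall>n. f n \<in> {T. herm T}" "f \<longlonglongrightarrow> l"
  have ap: "(\<lambda>n. ap (f n) x) \<longlonglongrightarrow> ap l x" for x
    using bounded_linear.tendsto[OF bounded_linear_ap f(2)] .
  have "bounded_linear st"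
    by (rule bounded_linear_intro[where K=1]) auto
  note st = bounded_linear.tendsto[OF this]
  show "herm l"
    unfolding herm_def
  proof (intro allI)
    fix x y
    have "(\<lambda>n. st y * ap (f n) x) \<longlonglongrightarrow> st y * ap l x"
      by (intro tendsto_intros ap)
    moreover have "(\<lambda>n. st y * ap (f n) x) \<longlonglongrightarrow> st (ap l y) * x"
      using f(1) by (simp add: herm_def) (intro tendsto_intros st ap)
    ultimately show "st y * ap l x = st (ap l y) * x"
      by (rule LIMSEQ_unique)
  qed
qed

lemma herm_sqrt_it: "herm T \<Longrightarrow> herm (sqrt_it T n)"
  by (induction n) (simp_all add: herm_mult)

lemma herm_rt: "herm T \<Longrightarrow> norm (1 - T) \<le> 1 \<Longrightarrow> herm (rt T)"
  using rt_closed[OF _ closed_herm] herm_sqrt_it by blast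

lemma sqrt_it_Lm: "sqrt_it (Lm a) n = Lm (sqrt_it a n)"
  by (induction n) auto

lemma rt_Lm: "norm (1 - Lm a) \<le> 1 \<Longrightarrow> rt (Lm a) \<in> range Lm" for a :: 'a
  by (rule rt_closed[OF _ closed_range_Lm]) (auto simp: sqrt_it_Lm)

text \<open>\<open>(S + iT)\<^sup>*(S + iT) = S\<^sup>2 + T\<^sup>2\<close> for commuting Hermitian \<open>S\<close>, \<open>T\<close>.\<close>

lemma norm_complex_comb:
  assumes "herm S" "herm T" "S * T = T * S"
  shows "(norm (ap S x + scA \<i> (ap T x)))\<^sup>2 = norm (st x * ap (S * S + T * T) x)"
proof -
  have comm: "ap S (ap T x) = ap T (ap S x)"
    using assms(3) by (metis ap_simps(7))
  have "st (ap S x + scA \<i> (ap T x)) * (ap S x + scA \<i> (ap T x)) =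
      st (ap S x) * ap S x + st (ap T x) * ap T x
      + scA \<i> (st (ap S x) * ap T x) + scA (- \<i>) (st (ap T x) * ap S x)"
    by (simp add: algebra_simps scA_add scA_mult_left scA_mult_right scA_scA)
  also have "\<dots> = st x * ap (S * S + T * T) x
      + (scA \<i> (st x * ap T (ap S x)) + scA (- \<i>) (st x * ap T (ap S x)))"
    using assms by (simp add: hermD comm algebra_simps)
  also have "scA \<i> (st x * ap T (ap S x)) + scA (- \<i>) (st x * ap T (ap S x)) = 0"
    using scA_real[of 0] by (simp flip: scA_add_left)
  finally show ?thesis
    by (simp only: norm_st_mult[symmetric] add_0_right)
qed

text \<open>Both \<open>S + i T\<close> and \<open>S - i T\<close> are \<open>sqrt t\<close> times
  an isometry, and \<open>S\<close> is half their sum.\<close>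

lemma norm_le_of_sum_squares:
  assumes "herm S" "herm T" "S * T = T * S" "S * S + T * T = t *\<^sub>R 1" "0 \<le> t"
  shows "norm S \<le> sqrt t"
proof (rule norm_endo_bound)
  fix x
  have *: "norm (ap S x + scA \<i> (ap T' x)) \<le> sqrt t * norm x"
    if "herm T'" "S * T' = T' * S" "T' * T' = T * T" for T'
  proof (rule power2_le_imp_le)
    have "(norm (ap S x + scA \<i> (ap T' x)))\<^sup>2 = norm (st x * ap (S * S + T * T) x)"
      using norm_complex_comb[OF assms(1) that(1,2), of x] that(3) by simp
    also have "\<dots> = t * (norm x)\<^sup>2"
      unfolding assms(4) using assms(5) by (simp add: norm_st_mult)
    finally show "(norm (ap S x + scA \<i> (ap T' x)))\<^sup>2 \<le> (sqrt t * norm x)\<^sup>2"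
      using assms(5) by (simp add: power_mult_distrib)
  qed (use assms(5) in simp)
  have "2 *\<^sub>R ap S x = (ap S x + scA \<i> (ap T x)) + (ap S x + scA \<i> (ap (- T) x))"
    by (simp add: scaleR_2)
  then have "norm (2 *\<^sub>R ap S x) \<le> norm (ap S x + scA \<i> (ap T x)) + norm (ap S x + scA \<i> (ap (- T) x))"
    by (simp only: norm_triangle_ineq)
  with *[of T] *[of "- T"] assms show "norm (ap S x) \<le> sqrt t * norm x"
    by simp
qed (use assms in simp)

lemma herm_norm_square: "herm T \<Longrightarrow> norm (T * T) = (norm T)\<^sup>2"
proof (rule antisym)
  assume "herm T"
  show "norm (T * T) \<le> (norm T)\<^sup>2"
    by (simp add: norm_mult_ineq power2_eq_square)
  have "norm T \<le> sqrt (norm (T * T))"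
  proof (rule norm_endo_bound)
    fix x
    have "(norm (ap T x))\<^sup>2 = norm (st x * ap (T * T) x)"
      using norm_st_mult[of "ap T x"] hermD[OF \<open>herm T\<close>, of x "ap T x"] by simp
    also have "\<dots> \<le> norm (st x) * norm (ap (T * T) x)"
      by (rule norm_mult_ineq)
    also have "\<dots> \<le> norm x * (norm (T * T) * norm x)"
      unfolding norm_st by (intro mult_left_mono norm_ap norm_ge_zero)
    also have "\<dots> = (sqrt (norm (T * T)) * norm x)\<^sup>2"
      by (simp add: power_mult_distrib) (simp add: power2_eq_square)
    finally show "norm (ap T x) \<le> sqrt (norm (T * T)) * norm x"
      by (rule power2_le_imp_le) simp
  qed simp
  then show "(norm T)\<^sup>2 \<le> norm (T * T)"
    by (metis norm_ge_zero power_mono real_sqrt_pow2)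
qed

lemma herm_square_eq_0: "herm T \<Longrightarrow> T * T = 0 \<longleftrightarrow> T = 0"
  using herm_norm_square[of T] by auto

section \<open>Positivity\<close>

text \<open>For Hermitian \<open>T\<close> the inequality says that the spectrum lies in
  \<open>[0, 2 t]\<close>.\<close>

definition pos :: "'a endo \<Rightarrow> bool" where
  "pos T \<longleftrightarrow> herm T \<and> (\<exists>t\<ge>0. norm (t *\<^sub>R 1 - T) \<le> t)"

lemma pos_herm: "pos T \<Longrightarrow> herm T"
  by (simp add: pos_def)

lemma pos_add: assumes "pos S" "pos T" shows "pos (S + T)"
proof -
  obtain s t where "0 \<le> s" "norm (s *\<^sub>R 1 - S) \<le> s" "0 \<le> t" "norm (t *\<^sub>R 1 - T) \<le> t"
    using assms by (auto simp: pos_def)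
  moreover have "(s + t) *\<^sub>R 1 - (S + T) = (s *\<^sub>R 1 - S) + (t *\<^sub>R 1 - T)"
    by (simp add: algebra_simps)
  ultimately have "norm ((s + t) *\<^sub>R 1 - (S + T)) \<le> s + t"
    by (metis norm_triangle_mono)
  with \<open>0 \<le> s\<close> \<open>0 \<le> t\<close> assms show ?thesis
    unfolding pos_def by (metis add_nonneg_nonneg herm_simps(3))
qed

lemma pos_scaleR: assumes "pos T" "0 \<le> r" shows "pos (r *\<^sub>R T)"
proof -
  obtain t where "0 \<le> t" "norm (t *\<^sub>R 1 - T) \<le> t"
    using assms by (auto simp: pos_def)
  moreover have "(r * t) *\<^sub>R 1 - r *\<^sub>R T = r *\<^sub>R (t *\<^sub>R 1 - T)"
    by (simp add: algebra_simps)
  ultimately have "norm ((r * t) *\<^sub>R 1 - r *\<^sub>R T) \<le> r * t"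
    using assms(2) by (simp add: mult_left_mono)
  moreover have "0 \<le> r * t"
    using assms(2) \<open>0 \<le> t\<close> by simp
  ultimately show ?thesis
    using assms(1) unfolding pos_def by (metis herm_simps(5))
qed

lemma pos_one: "pos 1"
  unfolding pos_def by (rule conjI, simp, rule exI[of _ 1]) simp

lemma pos_zero: "pos 0"
  unfolding pos_def by (rule conjI, simp, rule exI[of _ 0]) simp

text \<open>Enlarging the witness makes it positive and lets two operators share one, as
  \<open>pos_intertwine\<close> requires.\<close>

lemma pos_large:
  assumes "pos T" obtains t where "t > 0" "\<And>s. s \<ge> t \<Longrightarrow> norm (s *\<^sub>R 1 - T) \<le> s"
proof -
  obtain t where t: "0 \<le> t" "norm (t *\<^sub>R 1 - T) \<le> t"
    using assms by (auto simp: pos_def)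
  have "norm (s *\<^sub>R 1 - T) \<le> s" if "s \<ge> t" for s
  proof -
    have "s *\<^sub>R 1 - T = (s - t) *\<^sub>R 1 + (t *\<^sub>R 1 - T)"
      by (simp add: algebra_simps)
    also have "norm \<dots> \<le> norm ((s - t) *\<^sub>R (1 :: 'a endo)) + t"
      using t by (intro norm_triangle_mono) auto
    also have "norm ((s - t) *\<^sub>R (1 :: 'a endo)) \<le> s - t"
      using that mult_left_mono[OF norm_one_endo, of "s - t"] by simp
    finally show ?thesis by simp
  qed
  then show ?thesis
    using that[of "t + 1"] t by simp
qed

text \<open>Division by \<open>t\<close> brings \<open>T\<close> into the range where the iteration
  converges. \<open>t\<close> stays a parameter because \<open>sq_intertwines\<close> compares roots
  at a common scale.\<close>

definition sq :: "real \<Rightarrow> 'a endo \<Rightarrow> 'a endo" where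
  "sq t T = sqrt t *\<^sub>R rt ((1 / t) *\<^sub>R T)"

lemma rescale:
  assumes "t > 0" "norm (t *\<^sub>R 1 - T) \<le> t" shows "norm (1 - (1 / t) *\<^sub>R T :: 'a endo) \<le> 1"
proof -
  have "1 - (1 / t) *\<^sub>R T = (1 / t) *\<^sub>R (t *\<^sub>R 1 - T)"
    using assms(1) by (simp add: algebra_simps)
  then have "norm (1 - (1 / t) *\<^sub>R T) = norm (t *\<^sub>R 1 - T) / t"
    using assms(1) by simp
  with assms show ?thesis by (simp only: divide_le_eq_1_pos)
qed

lemma sq_square:
  assumes "t > 0" "norm (t *\<^sub>R 1 - T) \<le> t" shows "sq t T * sq t T = T"
  using rt_square[OF rescale[OF assms]] assms(1) by (simp add: sq_def)

lemma sq_intertwines: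
  assumes "t > 0" "norm (t *\<^sub>R 1 - T) \<le> t" "norm (t *\<^sub>R 1 - T') \<le> t" "X * T = T' * X"
  shows "X * sq t T = sq t T' * X"
  using rt_intertwines[OF rescale[OF assms(1,2)] rescale[OF assms(1,3)], of X] assms
  by (simp add: sq_def)

lemma pos_sq:
  assumes "herm T" "t > 0" "norm (t *\<^sub>R 1 - T) \<le> t" shows "pos (sq t T)"
proof -
  have "pos (rt ((1 / t) *\<^sub>R T))"
    using norm_one_minus_rt[OF rescale[OF assms(2,3)]] herm_rt[OF _ rescale[OF assms(2,3)]] assms
    unfolding pos_def by (intro conjI exI[of _ 1]) auto
  with assms show ?thesis
    by (simp add: sq_def pos_scaleR)
qed

lemma sq_Lm:
  assumes "t > 0" "norm (t *\<^sub>R 1 - Lm a) \<le> t" shows "sq t (Lm a) \<in> range Lm"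
proof -
  have "rt (Lm ((1 / t) *\<^sub>R a)) \<in> range Lm"
    using rt_Lm[of "(1 / t) *\<^sub>R a"] rescale[OF assms] by simp
  then obtain b where "rt (Lm ((1 / t) *\<^sub>R a)) = Lm b" by blast
  then have "sq t (Lm a) = Lm (sqrt t *\<^sub>R b)"
    by (simp add: sq_def)
  then show ?thesis by blast
qed

lemma pos_sqrt:
  assumes "pos T"
  obtains S where "pos S" "S * S = T" "\<And>X. X * T = T * X \<Longrightarrow> X * S = S * X"
proof -
  obtain t where t: "t > 0" "norm (t *\<^sub>R 1 - T) \<le> t"
    using pos_large[OF assms] by blast
  show ?thesis
    by (rule that[OF pos_sq[OF pos_herm[OF assms] t] sq_square[OF t] sq_intertwines[OF t t(2)]])
qed

lemma pos_Lm_sqrt: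
  assumes "pos (Lm a)" obtains b where "pos (Lm b)" "b * b = a"
proof -
  obtain t where t: "t > 0" "norm (t *\<^sub>R 1 - Lm a) \<le> t"
    using pos_large[OF assms] by blast
  then obtain b where b: "sq t (Lm a) = Lm b"
    using sq_Lm by blast
  have "b * b = a"
    using sq_square[OF t] b Lm_inject[of "b * b" a] by simp
  then show ?thesis
    using that[of b] pos_sq[OF pos_herm[OF assms] t] b by simp
qed

text \<open>\<open>T + i sqrt (1 - T\<^sup>2)\<close> is unitary when \<open>T\<close> is a Hermitian contraction.\<close>

lemma norm_one_minus_square:
  assumes "herm T" "norm T \<le> 1" shows "norm (1 - T * T) \<le> 1"
proof -
  have hT: "herm (1 - T * T)"
    using assms(1) by (intro herm_simps herm_mult) auto
  have "norm (T * T) \<le> 1"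
    using assms by (simp add: herm_norm_square power_le_one)
  then have t: "norm (1 *\<^sub>R 1 - (1 - T * T)) \<le> 1" by simp
  let ?s = "sq 1 (1 - T * T)"
  have s: "?s * ?s = 1 - T * T" "herm ?s"
    using sq_square[OF _ t] pos_sq[OF hT _ t] by (auto simp: pos_herm)
  have "T * (1 - T * T) = (1 - T * T) * T"
    by (simp add: algebra_simps)
  then have "?s * T = T * ?s"
    using sq_intertwines[OF _ t t, of T] by simp
  \<comment> \<open>\<open>?s\<close> and \<open>T\<close> are the two parts of the unitary, so
    \<open>?s\<close> is a contraction as well.\<close>
  then have "norm ?s \<le> sqrt 1"
    by (rule norm_le_of_sum_squares[OF s(2) assms(1)]) (use s in auto)
  then show ?thesis
    using herm_norm_square[OF s(2)] s(1) by (simp add: power_le_one)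
qed

lemma norm_diff_square:
  assumes "herm T" "norm (T * T) \<le> t" shows "norm (t *\<^sub>R 1 - T * T) \<le> t"
proof (cases "t = 0")
  case True
  with assms show ?thesis by simp
next
  case False
  then have t: "t > 0"
    using assms(2) norm_ge_zero[of "T * T"] by linarith
  let ?T = "(1 / sqrt t) *\<^sub>R T"
  have "norm T \<le> sqrt t"
    using assms by (simp add: herm_norm_square real_le_rsqrt)
  then have "norm ?T \<le> 1"
    using t by (simp add: field_simps)
  then have "norm (1 - ?T * ?T) \<le> 1"
    using assms(1) by (intro norm_one_minus_square) auto
  moreover have "t *\<^sub>R 1 - T * T = t *\<^sub>R (1 - ?T * ?T)"
    using t by (simp add: algebra_simps)
  ultimately show ?thesis
    using t mult_left_mono[of "norm (1 - ?T * ?T)" 1 t] by simp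
qed

lemma pos_square: "herm T \<Longrightarrow> pos (T * T)"
  unfolding pos_def by (intro conjI exI[of _ "norm (T * T)"]) (auto intro: herm_mult norm_diff_square)

text \<open>As \<open>T\<close> is the square of a Hermitian operator, every
  \<open>t \<ge> norm T\<close> is a witness, not just some large \<open>t\<close>.\<close>

lemma pos_norm_diff: "pos T \<Longrightarrow> norm T \<le> t \<Longrightarrow> norm (t *\<^sub>R 1 - T) \<le> t"
  by (rule pos_sqrt[of T], assumption) (use norm_diff_square pos_herm in blast)

text \<open>Each root commutes with whatever commutes with its square, so \<open>e\<close> and
  \<open>f\<close> commute and \<open>S * T = (e * f) * (e * f)\<close>.\<close>

lemma pos_mult:
  assumes "pos S" "pos T" "S * T = T * S" shows "pos (S * T)"
proof -
  obtain e where e: "pos e" "e * e = S" "\<And>X. X * S = S * X \<Longrightarrow> X * e = e * X"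
    by (rule pos_sqrt[OF assms(1)], rule that)
  obtain f where f: "pos f" "f * f = T" "\<And>X. X * T = T * X \<Longrightarrow> X * f = f * X"
    by (rule pos_sqrt[OF assms(2)], rule that)
  have "e * T = T * e"
    using e(3)[of T] assms(3) by simp
  then have ef: "e * f = f * e"
    by (rule f(3))
  then have "(e * f) * (e * f) = S * T"
    by (metis e(2) f(2) mult.assoc)
  with pos_square[OF herm_mult[OF pos_herm[OF e(1)] pos_herm[OF f(1)] ef]] show ?thesis
    by simp
qed

text \<open>The roots of \<open>T\<close> and of \<open>t - T\<close> commute and their squares add
  up to \<open>t\<close>, so \<open>norm_le_of_sum_squares\<close> applies.\<close>

lemma pos_norm_le:
  assumes "pos T" "pos (t *\<^sub>R 1 - T)" "0 \<le> t" shows "norm T \<le> t"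
proof -
  obtain e where e: "pos e" "e * e = T" "\<And>X. X * T = T * X \<Longrightarrow> X * e = e * X"
    by (rule pos_sqrt[OF assms(1)], rule that)
  obtain f where f: "pos f" "f * f = t *\<^sub>R 1 - T"
      "\<And>X. X * (t *\<^sub>R 1 - T) = (t *\<^sub>R 1 - T) * X \<Longrightarrow> X * f = f * X"
    by (rule pos_sqrt[OF assms(2)], rule that)
  have "e * T = T * e"
    using e(3)[of T] by simp
  then have ef: "e * f = f * e"
    by (intro f(3)) (simp add: algebra_simps)
  have "e * e + f * f = t *\<^sub>R 1"
    by (simp add: e(2) f(2))
  from norm_le_of_sum_squares[OF pos_herm[OF e(1)] pos_herm[OF f(1)] ef this assms(3)]
  have "norm e \<le> sqrt t" .
  then have "(norm e)\<^sup>2 \<le> t"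
    using assms(3) by (metis norm_ge_zero power_mono real_sqrt_pow2)
  then show ?thesis
    using herm_norm_square[OF pos_herm[OF e(1)]] e(2) by simp
qed

lemma pos_antisym: "pos T \<Longrightarrow> pos (- T) \<Longrightarrow> T = 0"
  using pos_norm_le[of T 0] by simp

text \<open>Both \<open>B\<close> and \<open>D\<close> are compared with the root \<open>S\<close>
  of \<open>pos_sqrt\<close>, which commutes with them. With \<open>u = B - S\<close>, the positive
  operators \<open>u * u * B\<close> and \<open>u * u * S\<close> sum to 0, so both vanish and
  \<open>u * u * u = 0\<close>.\<close>

lemma pos_sqrt_unique:
  assumes "pos B" "pos D" "B * B = D * D" shows "B = D"
proof -
  have *: "B = S" if S: "pos B" "pos S" "B * B = S * S" "B * S = S * B" for B S
  proof -
    let ?u = "B - S"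
    have u: "herm ?u" using S by (simp add: pos_herm)
    have posu: "pos (?u * ?u * X)" if "pos X" "X * B = B * X" "X * S = S * X" for X
    proof (rule pos_mult[OF pos_square[OF u] that(1)])
      have "?u * X = X * ?u" using that by (simp add: algebra_simps)
      then show "?u * ?u * X = X * (?u * ?u)" by (metis mult.assoc)
    qed
    have "?u * ?u * B + ?u * ?u * S = ?u * (?u * (B + S))"
      by (simp add: algebra_simps)
    also have "?u * (B + S) = 0"
      using S(3,4) by (simp add: algebra_simps)
    finally have sum0: "?u * ?u * B + ?u * ?u * S = 0" by simp
    then have "- (?u * ?u * B) = ?u * ?u * S"
      by (rule minus_unique)
    then have "pos (- (?u * ?u * B))"
      using posu[OF S(2)] S(4) by (simp only: simp_thms)
    then have "?u * ?u * B = 0"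
      using posu[OF S(1)] S(4) by (intro pos_antisym) auto
    with sum0 have "?u * ?u * ?u = 0"
      by (simp add: right_diff_distrib)
    then have "(?u * ?u) * (?u * ?u) = 0"
      by (metis mult.assoc mult_zero_right)
    then have "?u = 0"
      using u by (simp add: herm_square_eq_0 herm_mult)
    then show ?thesis by simp
  qed
  obtain S where S: "pos S" "S * S = B * B" "\<And>X. X * (B * B) = (B * B) * X \<Longrightarrow> X * S = S * X"
    by (rule pos_sqrt[OF pos_square[OF pos_herm[OF assms(1)]]], rule that)
  have "B = S"
    using S by (intro *[OF assms(1)]) (auto simp: mult.assoc)
  moreover have "D = S"
    using S assms by (intro *[OF assms(2)]) (auto simp: mult.assoc)
  ultimately show ?thesis by simp
qed

text \<open>By uniqueness \<open>B\<close> and \<open>D\<close> are the roots \<open>sq r\<close> at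
  a common scale \<open>r\<close>, for which intertwining is known.\<close>

lemma pos_intertwine:
  assumes "pos B" "pos D" "X * (B * B) = (D * D) * X" shows "X * B = D * X"
proof -
  have BB: "pos (B * B)" and DD: "pos (D * D)"
    using assms by (auto intro: pos_square pos_herm)
  obtain s where s: "s > 0" "\<And>r. r \<ge> s \<Longrightarrow> norm (r *\<^sub>R 1 - B * B) \<le> r"
    using pos_large[OF BB] by blast
  obtain t where t: "t > 0" "\<And>r. r \<ge> t \<Longrightarrow> norm (r *\<^sub>R 1 - D * D) \<le> r"
    using pos_large[OF DD] by blast
  define r where "r = max s t"
  have r: "r > 0" "norm (r *\<^sub>R 1 - B * B) \<le> r" "norm (r *\<^sub>R 1 - D * D) \<le> r"
    using s t by (auto simp: r_def)
  have "sq r (B * B) = B" "sq r (D * D) = D"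
    using r sq_square[OF r(1,2)] sq_square[OF r(1,3)] pos_sq[OF pos_herm[OF BB] r(1,2)]
      pos_sq[OF pos_herm[OF DD] r(1,3)] assms(1,2) pos_sqrt_unique by blast+
  with sq_intertwines[OF r assms(3)] show ?thesis
    by simp
qed

lemma pos_Lm_square: "st a = a \<Longrightarrow> pos (Lm (a * a))"
  using pos_square[of "Lm a"] by simp

lemma st_pos_Lm: "pos (Lm a) \<Longrightarrow> st a = a"
  using pos_herm by fastforce

lemma pos_Lm_intertwine:
  assumes "pos (Lm b)" "pos (Lm d)" "x * (b * b) = (d * d) * x" shows "x * b = d * x"
proof -
  have "Lm x * (Lm b * Lm b) = (Lm d * Lm d) * Lm x"
    by (simp only: assms(3) flip: Lm_simps(6))
  from pos_intertwine[OF assms(1,2) this] have "Lm (x * b) = Lm (d * x)" by simp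
  then show ?thesis by (simp only: Lm_inject)
qed

text \<open>The Fukamiya--Kelley--Vaught theorem. With \<open>c = a\<^sup>*a\<close>, \<open>d = |c|\<close>, \<open>m = d - c\<close> and
  \<open>x = a m\<close> one has \<open>x\<^sup>*x = - d m\<^sup>2 \<le> 0\<close> whereas \<open>x x\<^sup>* \<ge> 0\<close>. Then \<open>x\<close> intertwines \<open>- x\<^sup>*x\<close> with
  \<open>- x x\<^sup>*\<close>, hence their squares, hence also the positive roots of these squares; the two
  relations differ by a sign and force \<open>x\<^sup>*x = 0\<close>.\<close>

lemma pos_st_mult: "pos (Lm (st a * a))"
proof -
  define c where "c = st a * a"
  have c: "st c = c" by (simp add: c_def)
  obtain d where d: "pos (Lm d)" "d * d = c * c"
    using pos_Lm_sqrt[OF pos_Lm_square[OF c]] by blast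
  \<comment> \<open>This root makes \<open>d * m * m = (e * m) * (e * m)\<close> visibly
    positive.\<close>
  obtain e where e: "pos (Lm e)" "e * e = d"
    using pos_Lm_sqrt[OF d(1)] by blast
  have cd: "c * d = d * c"
    by (rule pos_Lm_intertwine[OF d(1) d(1)]) (simp add: d(2) mult.assoc)
  define m where "m = d - c"
  have m: "st m = m" using st_pos_Lm[OF d(1)] c by (simp add: m_def)
  have md: "m * d = d * m" using cd by (simp add: m_def algebra_simps)
  have em: "m * e = e * m"
    by (rule pos_Lm_intertwine[OF e(1) e(1)]) (simp add: e(2) md)
  have st_em: "st (e * m) = e * m"
    using st_pos_Lm[OF e(1)] m em by simp
  have mc: "m * c = - (d * m)"
    using d(2) by (simp add: m_def algebra_simps)
  define x where "x = a * m"
  define p where "p = (e * m) * (e * m)"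
  have p_eq: "p = d * m * m"
    unfolding p_def by (metis e(2) em mult.assoc)
  have "st x * x = m * c * m"
    by (simp add: x_def c_def m mult.assoc)
  then have xx: "st x * x = - p"
    by (simp add: mc p_eq)
  have p: "pos (Lm p)"
    unfolding p_def by (rule pos_Lm_square[OF st_em])
  define q where "q = x * st x"
  \<comment> \<open>Self-adjoint parts of \<open>x = h + i k\<close>; then
    \<open>x * st x + st x * x = 2 (h * h + k * k)\<close>, which with \<open>st x * x = - p\<close>
    makes \<open>q\<close> positive.\<close>
  define h where "h = (1/2) *\<^sub>R (x + st x)"
  define k where "k = scA (- \<i> / 2) (x - st x)"
  have h: "st h = h" by (simp add: h_def add.commute)
  have "st k = scA (\<i> / 2) (- (x - st x))" by (simp add: k_def)
  also have "\<dots> = scA (- \<i> / 2) (x - st x)"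
  proof -
    have "scA (\<i> / 2) (- (x - st x)) + scA (\<i> / 2) (x - st x) = 0"
      by (simp flip: scA_add)
    moreover have "scA (- \<i> / 2) (x - st x) + scA (\<i> / 2) (x - st x) = 0"
      using scA_real[of 0] by (simp flip: scA_add_left)
    ultimately show ?thesis
      by (metis add_right_imp_eq)
  qed
  finally have k: "st k = k" by (simp add: k_def)
  have "k * k = scA (- 1 / 4) ((x - st x) * (x - st x))"
    by (simp add: k_def scA_mult_left scA_mult_right scA_scA)
  also have "\<dots> = (- 1 / 4) *\<^sub>R ((x - st x) * (x - st x))"
    by (metis scA_real of_real_minus of_real_1 of_real_divide of_real_numeral)
  finally have kk: "k * k = (- 1 / 4) *\<^sub>R ((x - st x) * (x - st x))" .
  have hh: "h * h = (1 / 4) *\<^sub>R ((x + st x) * (x + st x))"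
    by (simp add: h_def)
  have "4 *\<^sub>R (h * h + k * k) = (x + st x) * (x + st x) - (x - st x) * (x - st x)"
    unfolding hh kk by (simp add: scaleR_right_diff_distrib)
  also have "\<dots> = 2 *\<^sub>R (q + st x * x)"
    by (simp add: q_def algebra_simps scaleR_2)
  finally have "2 *\<^sub>R (2 *\<^sub>R (h * h + k * k)) = 2 *\<^sub>R (q + st x * x)" by simp
  then have "q = 2 *\<^sub>R (h * h + k * k) + p"
    using xx by (simp only: scaleR_cancel_left) simp
  moreover have "pos (Lm (h * h + k * k))"
    using pos_add[OF pos_Lm_square[OF h] pos_Lm_square[OF k]] by simp
  ultimately have q: "pos (Lm q)"
    using p pos_add pos_scaleR by simp
  have xp: "x * p = - (q * x)"
    using xx by (metis q_def mult.assoc minus_minus mult_minus_right)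
  have "x * (p * p) = (x * p) * p" by (simp add: mult.assoc)
  also have "\<dots> = - (q * (x * p))" by (simp add: xp mult.assoc)
  also have "\<dots> = q * q * x" by (simp add: xp mult.assoc)
  finally have xp': "x * p = q * x"
    by (rule pos_Lm_intertwine[OF p q])
  then have "q * x = - (q * x)"
    using xp by (rule subst)
  then have "2 *\<^sub>R (q * x) = 0"
    unfolding scaleR_2 eq_neg_iff_add_eq_0 .
  with xp' have xp0: "x * p = 0"
    by simp
  have "p * p = - (st x * (x * p))"
    using xx by (metis minus_minus mult_minus_left mult.assoc)
  with xp0 have "st p * p = 0"
    by (simp add: st_pos_Lm[OF p])
  then have "p = 0"
    by (simp only: st_mult_eq_0)
  \<comment> \<open>Back to \<open>m = 0\<close>, that is \<open>c = d\<close>: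
    \<open>e * m\<close>, \<open>d * m\<close> and \<open>m * m = 2 d m\<close> vanish in
    turn.\<close>
  then have "st (e * m) * (e * m) = 0"
    by (simp only: st_em p_def)
  then have "e * m = 0"
    by (simp only: st_mult_eq_0)
  then have "d * m = 0"
    by (metis e(2) mult.assoc mult_zero_right)
  moreover have "m * m = d * m + d * m"
    using cd d(2) by (simp add: m_def algebra_simps)
  ultimately have "st m * m = 0"
    by (simp add: m)
  then have "m = 0"
    by (simp only: st_mult_eq_0)
  with d(1) show ?thesis
    by (simp add: m_def c_def)
qed

section \<open>Order and square roots in the algebra itself\<close>

lemma cpos_iff: "cpos st a \<longleftrightarrow> pos (Lm a)"
proof
  assume "pos (Lm a)"
  then obtain b where "pos (Lm b)" "b * b = a" by (rule pos_Lm_sqrt)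
  then show "cpos st a" unfolding cpos_def by (metis st_pos_Lm)
qed (auto simp: cpos_def pos_st_mult simp del: Lm_simps)

lemma cpos_st_mult [simp]: "cpos st (st a * a)"
  unfolding cpos_def by blast

lemma cpos_st: "cpos st a \<Longrightarrow> st a = a"
  by (auto simp: cpos_def)

lemma cpos_add: "cpos st a \<Longrightarrow> cpos st b \<Longrightarrow> cpos st (a + b)"
  using pos_add by (simp add: cpos_iff)

lemma cpos_scaleR: "cpos st a \<Longrightarrow> 0 \<le> r \<Longrightarrow> cpos st (r *\<^sub>R a)"
  using pos_scaleR by (simp add: cpos_iff)

lemma cpos_0: "cpos st 0"
  using cpos_st_mult[of 0] by simp

lemma cpos_sum: "(\<And>i. i \<in> I \<Longrightarrow> cpos st (f i)) \<Longrightarrow> cpos st (sum f I)"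
  by (induction I rule: infinite_finite_induct) (auto simp: cpos_0 cpos_add)

text \<open>With \<open>S * S = T\<close> the element is \<open>st (S a) * S a\<close>. This
  provides conjugation by operators such as \<open>M - \<alpha>\<close> that need not lie in the
  algebra.\<close>

lemma cpos_ap: assumes "pos T" shows "cpos st (st a * ap T a)"
proof -
  obtain S where S: "pos S" "S * S = T"
    using pos_sqrt[OF assms] by metis
  have "st a * ap T a = st (ap S a) * ap S a"
    using hermD[OF pos_herm[OF S(1)], of a "ap S a"] S(2) by (metis ap_simps(7))
  then show ?thesis by simp
qed

lemma pos_diff_norm: "pos T \<Longrightarrow> norm T \<le> t \<Longrightarrow> pos (t *\<^sub>R 1 - T)"
  unfolding pos_def[of "_ - _"]
  using order_trans[OF norm_ge_zero] by (intro conjI exI[of _ t]) (auto simp: pos_herm)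

text \<open>\<open>norm b - a\<close> is the sum of the positive \<open>norm b - b\<close> and
  \<open>b - a\<close>; then \<open>pos_norm_le\<close> applies.\<close>

lemma cpos_norm_mono:
  assumes "cpos st a" "cpos st (b - a)" shows "norm a \<le> norm b"
proof -
  have "pos (Lm b)"
    using cpos_add[OF assms] by (simp add: cpos_iff)
  then have "pos ((norm b *\<^sub>R 1 - Lm b) + Lm (b - a))"
    using assms(2) by (intro pos_add pos_diff_norm) (auto simp: cpos_iff)
  then have "pos (norm b *\<^sub>R 1 - Lm a)"
    by simp
  then have "norm (Lm a) \<le> norm b"
    using assms(1) by (intro pos_norm_le) (auto simp: cpos_iff)
  then show ?thesis by simp
qed

text \<open>Existence and uniqueness of the positive root justify the definite description in
  \<open>csqrtA_def\<close>.\<close>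

lemma csqrtA:
  assumes "cpos st a"
  shows "cpos st (csqrtA st a)" "csqrtA st a * csqrtA st a = a"
proof -
  obtain c where c: "pos (Lm c)" "c * c = a"
    using assms pos_Lm_sqrt unfolding cpos_iff by blast
  have "cpos st (csqrtA st a) \<and> csqrtA st a * csqrtA st a = a"
    unfolding csqrtA_def
  proof (rule theI[of _ c])
    fix c' assume c': "cpos st c' \<and> c' * c' = a"
    then have "Lm c' * Lm c' = Lm c * Lm c"
      by (simp only: c(2) flip: Lm_simps(6))
    from pos_sqrt_unique[OF _ c(1) this] c' have "Lm c' = Lm c"
      by (simp add: cpos_iff)
    then show "c' = c" by simp
  qed (use c in \<open>simp add: cpos_iff\<close>)
  then show "cpos st (csqrtA st a)" "csqrtA st a * csqrtA st a = a" by auto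
qed

lemma cabsA_square: "cabsA st a * cabsA st a = st a * a"
  unfolding cabsA_def by (rule csqrtA) simp

lemma norm_csqrtA: assumes "cpos st a" shows "norm (csqrtA st a) = sqrt (norm a)"
proof -
  have "(norm (csqrtA st a))\<^sup>2 = norm a"
    using norm_st_mult[of "csqrtA st a"] csqrtA[OF assms] cpos_st by simp
  then show ?thesis by (metis norm_ge_zero real_sqrt_unique)
qed

text \<open>Expanding \<open>\<langle>t v \<beta> - w, t v \<beta> - w\<rangle> \<ge> 0\<close> for \<open>\<alpha> = \<langle>v, v\<rangle>\<close>, \<open>\<beta> = \<langle>v, w\<rangle>\<close>, \<open>\<gamma> = \<langle>w, w\<rangle>\<close> gives the
  last hypothesis, so this is the Cauchy--Schwarz inequality for any \<open>\<AA>\<close>-valued inner product.\<close>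

lemma cauchy_schwarz_core:
  assumes "cpos st \<alpha>" "norm \<alpha> \<le> M" "0 < M"
    and "\<And>t::real. cpos st (t\<^sup>2 *\<^sub>R (st \<beta> * \<alpha> * \<beta>) - (2 * t) *\<^sub>R (st \<beta> * \<beta>) + \<gamma>)"
  shows "cpos st (M *\<^sub>R \<gamma> - st \<beta> * \<beta>)"
proof -
  have "pos (M *\<^sub>R 1 - Lm \<alpha>)"
    using assms by (intro pos_diff_norm) (auto simp: cpos_iff)
  from cpos_ap[OF this, of \<beta>] have "cpos st (M *\<^sub>R (st \<beta> * \<beta>) - st \<beta> * \<alpha> * \<beta>)"
    by (simp add: algebra_simps)
  moreover have "(M * 2) *\<^sub>R (st \<beta> * \<beta>) = M *\<^sub>R (st \<beta> * \<beta>) + M *\<^sub>R (st \<beta> * \<beta>)"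
    by (simp only: mult_2_right scaleR_add_left)
  \<comment> \<open>The hypothesis at \<open>t = 1 / M\<close>, times \<open>M\<^sup>2\<close>, is
    added to the first fact; the terms with \<open>\<alpha>\<close> cancel.\<close>
  ultimately have "cpos st (M\<^sup>2 *\<^sub>R \<gamma> - M *\<^sub>R (st \<beta> * \<beta>))"
    using cpos_add[OF cpos_scaleR[OF assms(4)[of "1 / M"], of "M\<^sup>2"]] assms(3)
    by (fastforce simp add: algebra_simps power2_eq_square)
  from cpos_scaleR[OF this, of "1 / M"] assms(3) show ?thesis
    by (simp add: algebra_simps power2_eq_square)
qed

text \<open>Since \<open>norm \<alpha>\<close> may be 0, the core lemma is used with
  \<open>M = norm \<alpha> + e\<close>, and \<open>e\<close> tends to 0.\<close>

lemma cauchy_schwarz_norm: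
  assumes "cpos st \<alpha>"
    and "\<And>t::real. cpos st (t\<^sup>2 *\<^sub>R (st \<beta> * \<alpha> * \<beta>) - (2 * t) *\<^sub>R (st \<beta> * \<beta>) + \<gamma>)"
  shows "(norm \<beta>)\<^sup>2 \<le> norm \<alpha> * norm \<gamma>"
proof -
  have *: "(norm \<beta>)\<^sup>2 \<le> (norm \<alpha> + e) * norm \<gamma>" if "e > 0" for e
  proof -
    have M: "0 < norm \<alpha> + e" using that by (simp add: add_nonneg_pos)
    have "cpos st ((norm \<alpha> + e) *\<^sub>R \<gamma> - st \<beta> * \<beta>)"
      by (rule cauchy_schwarz_core[OF assms(1) _ M assms(2)]) (use that in simp)
    from cpos_norm_mono[OF cpos_st_mult this] M show ?thesis
      by (simp add: norm_st_mult)
  qed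
  show ?thesis
  proof (rule field_le_epsilon)
    fix e :: real assume "e > 0"
    have "e / (norm \<gamma> + 1) * norm \<gamma> \<le> e"
      using \<open>e > 0\<close> add_nonneg_pos[OF norm_ge_zero[of \<gamma>] zero_less_one] by (simp add: field_simps)
    with *[of "e / (norm \<gamma> + 1)"] \<open>e > 0\<close> show "(norm \<beta>)\<^sup>2 \<le> norm \<alpha> * norm \<gamma> + e"
      by (simp add: distrib_right add_nonneg_pos)
  qed
qed

section \<open>Approximate polar decomposition\<close>

lemma pos_power: "pos V \<Longrightarrow> pos (V ^ n)"
  by (induction n) (auto simp: pos_one power_commutes intro: pos_mult)

lemma pos_sum: "(\<And>i. i \<in> I \<Longrightarrow> pos (f i)) \<Longrightarrow> pos (sum f I)"
  by (induction I rule: infinite_finite_induct) (auto simp: pos_zero pos_add)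

lemma norm_power_endo: "norm (V :: 'a endo) \<le> 1 \<Longrightarrow> norm (V ^ n) \<le> 1"
proof (induction n)
  case (Suc n)
  then have "norm V * norm (V ^ n) \<le> 1" by (intro mult_le_one) auto
  with norm_mult_ineq[of V "V ^ n"] show ?case by simp
qed (simp add: norm_one_endo)

lemma geometric_sum_endo: "(1 - V) * (\<Sum>j<m. V ^ j) = 1 - V ^ m" for V :: "'a endo"
proof (induction m)
  case (Suc m)
  show ?case
    unfolding sum.lessThan_Suc distrib_left Suc by (simp add: left_diff_distrib)
qed simp

text \<open>\<open>C\<^sup>2\<close> is a partial sum of the Neumann series \<open>r\<^sup>-\<^sup>1 \<Sum>\<^sub>j (1 - h/r)\<^sup>j\<close> of \<open>h\<^sup>-\<^sup>1\<close>, so that with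
  \<open>V = 1 - h/r\<close> the error is \<open>h V\<^sup>m\<close>, of norm at most \<open>r/m\<close> because \<open>m V\<^sup>m \<le> \<Sum>\<^sub>j\<^sub><\<^sub>m V\<^sup>j\<close>.\<close>

lemma approx_inverse_sqrt:
  assumes "cpos st h" "0 < \<epsilon>"
  obtains C where "herm C" "pos (1 - C * Lm h * C)" "norm (Lm h - Lm h * C * C * Lm h) \<le> \<epsilon>"
proof -
  \<comment> \<open>The summand 1 keeps \<open>r\<close> positive if \<open>h = 0\<close>.\<close>
  define r where "r = norm h + 1"
  have r: "r > 0" "norm h \<le> r" by (auto simp: r_def add_nonneg_pos)
  define T where "T = (1 / r) *\<^sub>R Lm h"
  define V where "V = 1 - T"
  have T: "pos T"
    using assms(1) r unfolding T_def cpos_iff by (intro pos_scaleR) auto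
  have nT: "norm T \<le> 1" using r by (simp add: T_def)
  have V: "pos V" "norm V \<le> 1"
    using pos_diff_norm[OF T nT] pos_norm_diff[OF T nT] by (auto simp: V_def)
  have TV: "T * V ^ j = V ^ j * T" for j
  proof -
    have "V ^ j * V = V * V ^ j" by (rule power_commutes)
    then show ?thesis by (simp add: V_def algebra_simps)
  qed
  obtain m :: nat where m: "r / \<epsilon> < real m"
    using reals_Archimedean2 by blast
  have m0: "real m > 0"
    using m r assms(2) by (meson divide_pos_pos less_trans)
  define Q where "Q = (\<Sum>j<m. V ^ j)"
  have Q: "pos Q"
    unfolding Q_def by (intro pos_sum pos_power V)
  have TQ: "T * Q = 1 - V ^ m"
    using geometric_sum_endo[of V m] by (simp add: V_def Q_def)
  have TQc: "T * Q = Q * T"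
    unfolding Q_def by (simp add: sum_distrib_left sum_distrib_right TV)
  obtain D where D: "pos D" "D * D = Q" "\<And>X. X * Q = Q * X \<Longrightarrow> X * D = D * X"
    by (rule pos_sqrt[OF Q], rule that)
  have TD: "T * D = D * T" by (rule D(3)[OF TQc])
  define C where "C = (1 / sqrt r) *\<^sub>R D"
  have CC: "C * C = (1 / r) *\<^sub>R Q"
    using r D(2) by (simp add: C_def)
  have h: "Lm h = r *\<^sub>R T"
    using r by (simp add: T_def)
  have "C * Lm h * C = (D * T) * D"
    using r by (simp add: C_def h)
  also have "\<dots> = 1 - V ^ m"
    by (metis TD D(2) TQ mult.assoc)
  finally have CTC: "1 - C * Lm h * C = V ^ m" by simp
  have "Lm h - Lm h * C * C * Lm h = r *\<^sub>R T - r *\<^sub>R T * (C * C) * (r *\<^sub>R T)"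
    by (simp add: h mult.assoc)
  also have "\<dots> = r *\<^sub>R (T - T * Q * T)"
    using r by (simp add: CC scaleR_right_diff_distrib)
  also have "T - T * Q * T = T * V ^ m"
    by (simp add: TQ left_diff_distrib TV)
  finally have diff: "Lm h - Lm h * C * C * Lm h = r *\<^sub>R (T * V ^ m)" .
  have TVm: "pos (T * V ^ m)"
    by (intro pos_mult T pos_power V TV)
  have pos_diff: "pos (V ^ j - V ^ m)" if "j < m" for j
  proof -
    have n: "pos (1 *\<^sub>R 1 - V ^ (m - j))"
      by (intro pos_diff_norm pos_power norm_power_endo V)
    have c: "V ^ j * V ^ (m - j) = V ^ (m - j) * V ^ j"
      by (simp flip: power_add add: add.commute)
    have "pos (V ^ j * (1 *\<^sub>R 1 - V ^ (m - j)))"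
      by (rule pos_mult[OF pos_power[OF V(1)] n]) (simp add: algebra_simps c)
    then show ?thesis
      using that by (simp add: right_diff_distrib flip: power_add)
  qed
  have "(\<Sum>j<m. V ^ j - V ^ m) = Q - real m *\<^sub>R V ^ m"
    by (simp add: Q_def sum_subtractf sum_constant_scaleR)
  then have "pos (Q - real m *\<^sub>R V ^ m)"
    using pos_sum[of "{..<m}" "\<lambda>j. V ^ j - V ^ m"] pos_diff by simp
  then have "pos (T * (Q - real m *\<^sub>R V ^ m))"
    by (rule pos_mult[OF T]) (simp add: algebra_simps TQc TV)
  \<comment> \<open>By \<open>TQ\<close> this sum equals \<open>1 - m T V ^ m\<close>, which bounds
    the norm of \<open>T * V ^ m\<close> by \<open>1 / m\<close>.\<close>
  then have "pos (V ^ m + T * (Q - real m *\<^sub>R V ^ m))"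
    by (intro pos_add pos_power V)
  then have "pos (1 *\<^sub>R 1 - real m *\<^sub>R (T * V ^ m))"
    by (simp add: right_diff_distrib TQ)
  then have "norm (real m *\<^sub>R (T * V ^ m)) \<le> 1"
    by (intro pos_norm_le pos_scaleR TVm) auto
  then have "norm (T * V ^ m) \<le> 1 / real m"
    using m0 by (simp add: field_simps)
  from mult_left_mono[OF this, of r] have "norm (r *\<^sub>R (T * V ^ m)) \<le> r * (1 / real m)"
    using r by simp
  also have "\<dots> \<le> \<epsilon>"
    using m m0 assms(2) by (simp add: field_simps)
  finally have "norm (Lm h - Lm h * C * C * Lm h) \<le> \<epsilon>"
    by (simp only: diff)
  moreover have "herm C" using D(1) by (simp add: C_def pos_herm)
  moreover have "pos (1 - C * Lm h * C)" unfolding CTC by (intro pos_power V)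
  ultimately show ?thesis by (rule that[rotated 2])
qed

text \<open>An approximate polar decomposition of the column \<open>(p, q)\<close>: the contraction \<open>(a, b)\<close> is
  \<open>(p, q) C\<close> where \<open>C\<close> approximates the inverse square root of \<open>p\<^sup>*p + q\<^sup>*q\<close>.\<close>

lemma approx_polar:
  assumes "0 < \<epsilon>"
  obtains a b where "norm (st a * a + st b * b) \<le> 1"
    "norm ((st p * p + st q * q) - st (st a * p + st b * q) * (st a * p + st b * q)) \<le> \<epsilon>"
proof -
  define h where "h = st p * p + st q * q"
  have h: "cpos st h" by (simp add: h_def cpos_add)
  obtain C where C: "herm C" "pos (1 - C * Lm h * C)" "norm (Lm h - Lm h * C * C * Lm h) \<le> \<epsilon>"
    using approx_inverse_sqrt[OF h assms] by blast
  \<comment> \<open>\<open>f x\<close> is the element \<open>x C\<close>; \<open>C\<close> itself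
    need not be a left multiplication, hence the detour through the adjoint.\<close>
  define f where "f x = st (ap C (st x))" for x
  have stf: "st (f x) = ap C (st x)" for x by (simp add: f_def)
  have Lf: "Lm (f x) = Lm x * C" for x
    by (rule endo_eqI) (simp add: f_def hermD[OF C(1)])
  have Lstf: "Lm (st (f x)) = C * Lm (st x)" for x
    unfolding stf by (rule herm_Lm_right[OF C(1), symmetric])
  define \<alpha> where "\<alpha> = st (f p) * f p + st (f q) * f q"
  have "Lm \<alpha> = C * Lm h * C"
    unfolding \<alpha>_def h_def by (simp add: Lf Lstf algebra_simps)
  then have "pos (1 *\<^sub>R 1 - Lm \<alpha>)" using C(2) by simp
  moreover have "cpos st \<alpha>" by (simp add: \<alpha>_def cpos_add)
  ultimately have "norm (Lm \<alpha>) \<le> 1"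
    by (intro pos_norm_le) (auto simp: cpos_iff)
  then have 1: "norm \<alpha> \<le> 1" by simp
  define w where "w = st (f p) * p + st (f q) * q"
  have w: "w = ap C h"
    unfolding w_def h_def stf by (simp add: herm_right[OF C(1)])
  have "st w * w = h * ap C (ap C h)"
    unfolding w by (simp add: hermD[OF C(1)] cpos_st[OF h])
  then have "Lm (h - st w * w) = Lm h - Lm h * (C * (C * Lm h))"
    by (simp add: herm_Lm_right[OF C(1)])
  then have "norm (h - st w * w) \<le> \<epsilon>"
    using C(3) norm_Lm[of "h - st w * w"] by (simp add: mult.assoc)
  then show ?thesis
    using that[of "f p" "f q"] 1 unfolding \<alpha>_def w_def h_def by blast
qed

section \<open>Columns\<close>

text \<open>Inner product of the column \<open>f\<close> with itself in the Hilbert module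
  \<open>A^n\<close>.\<close>

definition colsq :: "nat \<Rightarrow> (nat \<Rightarrow> 'a) \<Rightarrow> 'a" where
  "colsq n f = (\<Sum>i<n. st (f i) * f i)"

lemma colsq_simps [simp]: "colsq 0 f = 0" "colsq (Suc n) f = colsq n f + st (f n) * f n"
  by (simp_all add: colsq_def)

lemma cpos_colsq [simp]: "cpos st (colsq n f)"
  unfolding colsq_def by (rule cpos_sum) simp

lemma colsq_cong: "(\<And>i. i < n \<Longrightarrow> f i = g i) \<Longrightarrow> colsq n f = colsq n g"
  by (simp add: colsq_def)

lemma norm_colsq_le: "norm (colsq n f) \<le> (\<Sum>i<n. (norm (f i))\<^sup>2)"
  unfolding colsq_def by (rule order_trans[OF norm_sum]) (simp add: norm_st_mult)

lemma norm_le_colsq: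
  assumes "i < n" shows "(norm (f i))\<^sup>2 \<le> norm (colsq n f)"
proof -
  have "colsq n f - st (f i) * f i = (\<Sum>j\<in>{..<n} - {i}. st (f j) * f j)"
    using assms by (simp add: colsq_def sum_diff1)
  then have "cpos st (colsq n f - st (f i) * f i)"
    by (simp add: cpos_sum)
  from cpos_norm_mono[OF cpos_st_mult this] show ?thesis
    by (simp add: norm_st_mult)
qed

lemma colsq_expand:
  "(\<Sum>i<n. st (t *\<^sub>R (f i * b) - g i) * (t *\<^sub>R (f i * b) - g i)) =
    t\<^sup>2 *\<^sub>R (st b * colsq n f * b) - t *\<^sub>R (st b * (\<Sum>i<n. st (f i) * g i))
    - t *\<^sub>R (st (\<Sum>i<n. st (f i) * g i) * b) + colsq n g"
proof (induction n)
  case (Suc n)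
  show ?case
    unfolding sum.lessThan_Suc Suc by (simp add: algebra_simps power2_eq_square)
qed simp

text \<open>A sum of squares of \<open>t f b - g\<close>, giving the hypothesis of
  \<open>cauchy_schwarz_core\<close> for columns.\<close>

lemma colsq_gram_pos:
  assumes "b = (\<Sum>i<n. st (f i) * g i)"
  shows "cpos st (t\<^sup>2 *\<^sub>R (st b * colsq n f * b) - (2 * t) *\<^sub>R (st b * b) + colsq n g)"
proof -
  have "cpos st (\<Sum>i<n. st (t *\<^sub>R (f i * b) - g i) * (t *\<^sub>R (f i * b) - g i))"
    by (intro cpos_sum cpos_st_mult)
  moreover have "(2 * t) *\<^sub>R (st b * b) = t *\<^sub>R (st b * b) + t *\<^sub>R (st b * b)"
    by (simp only: mult_2 scaleR_add_left)
  ultimately show ?thesis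
    unfolding colsq_expand by (simp add: assms[symmetric] algebra_simps del: st_sum)
qed

text \<open>Cauchy--Schwarz with \<open>M = 1\<close>, kept as an inequality of elements because
  (A4) adds further summands to both sides.\<close>

lemma colsq_contraction:
  assumes "norm (colsq n f) \<le> 1" "b = (\<Sum>i<n. st (f i) * g i)"
  shows "cpos st (colsq n g - st b * b)"
  using cauchy_schwarz_core[OF cpos_colsq assms(1) zero_less_one colsq_gram_pos[OF assms(2)]]
  by simp

lemma norm_colsq_add:
  "sqrt (norm (colsq n (\<lambda>i. f i + g i))) \<le> sqrt (norm (colsq n f)) + sqrt (norm (colsq n g))"
proof -
  let ?b = "\<Sum>i<n. st (f i) * g i"
  have eq: "colsq n (\<lambda>i. f i + g i) = colsq n f + ?b + st ?b + colsq n g"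
    by (induction n) (simp_all add: algebra_simps)
  have "(norm ?b)\<^sup>2 \<le> norm (colsq n f) * norm (colsq n g)"
    by (rule cauchy_schwarz_norm[OF cpos_colsq colsq_gram_pos]) simp
  then have b: "norm ?b \<le> sqrt (norm (colsq n f)) * sqrt (norm (colsq n g))"
    by (simp add: real_le_rsqrt flip: real_sqrt_mult)
  have "norm (colsq n (\<lambda>i. f i + g i)) \<le> norm (colsq n f) + norm ?b + norm (st ?b) + norm (colsq n g)"
    unfolding eq by (intro norm_triangle_mono order_refl)
  also have "\<dots> \<le> (sqrt (norm (colsq n f)) + sqrt (norm (colsq n g)))\<^sup>2"
    unfolding norm_st using b by (simp add: power2_sum)
  finally show ?thesis
    by (rule real_le_lsqrt[rotated]) simp
qed

lemma colsq_mono: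
  assumes "\<And>i. i < n \<Longrightarrow> cpos st (st (g i) * g i - st (f i) * f i)"
  shows "norm (colsq n f) \<le> norm (colsq n g)"
proof (rule cpos_norm_mono[OF cpos_colsq])
  show "cpos st (colsq n g - colsq n f)"
    unfolding colsq_def sum_subtractf[symmetric] by (rule cpos_sum) (use assms in auto)
qed

end

section \<open>Hilbert modules\<close>

locale hilbert_mod =
  fixes scA :: "complex \<Rightarrow> 'a::{banach, real_normed_algebra} \<Rightarrow> 'a"
    and st :: "'a \<Rightarrow> 'a"
    and scX :: "complex \<Rightarrow> 'x::ab_group_add \<Rightarrow> 'x"
    and act :: "'x \<Rightarrow> 'a \<Rightarrow> 'x"
    and ip :: "'x \<Rightarrow> 'x \<Rightarrow> 'a"
  assumes hilbert: "hilbert_module scA st scX act ip"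

sublocale hilbert_mod \<subseteq> cstar scA st
  using hilbert by unfold_locales (simp add: hilbert_module_def)

context hilbert_mod
begin

lemma
  shows scX_mult: "scX (c * d) x = scX c (scX d x)"
    and scX_one [simp]: "scX 1 x = x"
    and ip_add_right [simp]: "ip x (y + z) = ip x y + ip x z"
    and ip_scX_right [simp]: "ip x (scX c y) = scA c (ip x y)"
    and ip_act_right [simp]: "ip x (act y a) = ip x y * a"
    and st_ip: "st (ip x y) = ip y x"
    and cpos_ip [simp]: "cpos st (ip x x)"
    and ip_eq_0: "ip x x = 0 \<Longrightarrow> x = 0"
  using hilbert unfolding hilbert_module_def by metis+

lemma ip_add_left [simp]: "ip (x + y) z = ip x z + ip y z"
  by (metis st_ip st_add ip_add_right)

lemma ip_scX_left [simp]: "ip (scX c x) z = scA (cnj c) (ip x z)"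
  by (metis st_ip st_scA ip_scX_right)

lemma ip_act_left [simp]: "ip (act x a) z = st a * ip x z"
  by (metis st_ip st_mult ip_act_right)

lemma ip_0 [simp]: "ip x 0 = 0" "ip 0 x = 0"
  using ip_add_right[of x 0 0] ip_add_left[of 0 0 x] by auto

lemma ip_minus [simp]: "ip x (- y) = - ip x y" "ip (- x) y = - ip x y"
  using ip_add_right[of x "- y" y] ip_add_left[of "- x" x y] by (auto simp: eq_neg_iff_add_eq_0)

lemma ip_diff [simp]: "ip x (y - z) = ip x y - ip x z" "ip (x - y) z = ip x z - ip y z"
  using ip_add_right[of x y "- z"] ip_add_left[of x "- y" z] by auto

lemma norm_ip: "(norm (ip x y))\<^sup>2 \<le> norm (ip x x) * norm (ip y y)"
proof (rule cauchy_schwarz_norm)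
  fix t :: real
  let ?b = "ip x y"
  have "cpos st (ip (scX (complex_of_real t) (act x ?b) - y) (scX (complex_of_real t) (act x ?b) - y))"
    by (rule cpos_ip)
  moreover have "(2 * t) *\<^sub>R (st ?b * ?b) = t *\<^sub>R (st ?b * ?b) + t *\<^sub>R (st ?b * ?b)"
    by (simp only: mult_2 scaleR_add_left)
  ultimately show "cpos st (t\<^sup>2 *\<^sub>R (st ?b * ip x x * ?b) - (2 * t) *\<^sub>R (st ?b * ?b) + ip y y)"
    by (simp add: scA_real st_ip algebra_simps power2_eq_square)
qed simp

lemma hnorm_scX: "hnorm ip (scX c x) = cmod c * hnorm ip x"
  by (simp add: hnorm_def real_sqrt_mult flip: mult.assoc)

lemma hnorm_nonneg [simp]: "0 \<le> hnorm ip x"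
  by (simp add: hnorm_def)

lemma hnorm_square: "(hnorm ip x)\<^sup>2 = norm (ip x x)"
  by (simp add: hnorm_def)

lemma hnorm_eq_0: "hnorm ip x = 0 \<longleftrightarrow> x = 0"
  using ip_eq_0 by (auto simp: hnorm_def)

lemma hnorm_pos: "0 < hnorm ip x \<longleftrightarrow> x \<noteq> 0"
  using hnorm_eq_0[of x] hnorm_nonneg[of x] by linarith

section \<open>Admissible families and elimination of the square roots\<close>

abbreviation pairing :: "'x list \<Rightarrow> 'x list \<Rightarrow> 'a" where
  "pairing ys xs \<equiv> colsq (length xs) (\<lambda>i. ip (ys ! i) (xs ! i))"

text \<open>Homogeneous form of \<open>mu_star st ip ys \<le> 1\<close>: all \<open>z\<close>
  instead of the unit ball, and no supremum.\<close>

definition admissible :: "'x list \<Rightarrow> bool" where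
  "admissible ys \<longleftrightarrow> (\<forall>z. norm (colsq (length ys) (\<lambda>i. ip (ys ! i) z)) \<le> norm (ip z z))"

lemma admissibleD: "admissible ys \<Longrightarrow> i < length ys \<Longrightarrow> (norm (ip (ys ! i) z))\<^sup>2 \<le> norm (ip z z)"
  unfolding admissible_def using norm_le_colsq order_trans by blast

lemma mu_star_altdef:
  "mu_star st ip ys = Sup {sqrt (norm (colsq (length ys) (\<lambda>i. ip (ys ! i) z))) |z. hnorm ip z \<le> 1}"
  unfolding mu_star_def cabsA_square colsq_def[symmetric]
  by (simp add: norm_csqrtA)

text \<open>Cauchy--Schwarz bounds the set, so its \<open>Sup\<close> dominates each member;
  rescaling \<open>z\<close> to norm 1 then reaches all \<open>z\<close>.\<close>

lemma mu_star_le_1: "mu_star st ip ys \<le> 1 \<longleftrightarrow> admissible ys"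
proof
  let ?f = "\<lambda>z. colsq (length ys) (\<lambda>i. ip (ys ! i) z)"
  let ?S = "{sqrt (norm (?f z)) |z. hnorm ip z \<le> 1}"
  assume "mu_star st ip ys \<le> 1"
  then have S: "Sup ?S \<le> 1" by (simp add: mu_star_altdef)
  have "bdd_above ?S"
  proof (rule bdd_aboveI, safe)
    fix z assume "hnorm ip z \<le> 1"
    then have z: "norm (ip z z) \<le> 1" by (simp add: hnorm_def)
    have "(norm (ip (ys ! i) z))\<^sup>2 \<le> norm (ip (ys ! i) (ys ! i))" for i
      using norm_ip[of "ys ! i" z] mult_left_mono[OF z, of "norm (ip (ys ! i) (ys ! i))"] by simp
    then have "norm (?f z) \<le> (\<Sum>i<length ys. norm (ip (ys ! i) (ys ! i)))"
      by (intro order_trans[OF norm_colsq_le] sum_mono)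
    then show "sqrt (norm (?f z)) \<le> sqrt (\<Sum>i<length ys. norm (ip (ys ! i) (ys ! i)))"
      by simp
  qed
  moreover have "sqrt (norm (?f z)) \<in> ?S" if "hnorm ip z \<le> 1" for z
    using that by blast
  ultimately have "sqrt (norm (?f z)) \<le> 1" if "hnorm ip z \<le> 1" for z
    using that S cSup_upper order_trans by meson
  then have 1: "norm (?f z) \<le> 1" if "hnorm ip z \<le> 1" for z
    using that by simp
  show "admissible ys"
    unfolding admissible_def
  proof
    fix z
    show "norm (?f z) \<le> norm (ip z z)"
    proof (cases "z = 0")
      case False
      define r where "r = hnorm ip z"
      have r: "r > 0"
        using False by (simp add: r_def hnorm_pos)
      let ?z = "scX (complex_of_real (1 / r)) z"
      have "hnorm ip ?z \<le> 1"
        using r unfolding hnorm_scX by (simp add: r_def norm_divide)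
      moreover have "?f ?z = (1 / r)\<^sup>2 *\<^sub>R ?f z"
        unfolding colsq_def scaleR_sum_right
        by (simp add: scA_real power2_eq_square del: of_real_divide)
      ultimately have "(1 / r)\<^sup>2 * norm (?f z) \<le> 1"
        using 1[of ?z] by simp
      then show ?thesis
        using r by (simp add: field_simps hnorm_square[symmetric] r_def)
    qed (simp add: colsq_def)
  qed
next
  assume adm: "admissible ys"
  show "mu_star st ip ys \<le> 1"
    unfolding mu_star_altdef
  proof (rule cSup_least)
    have "hnorm ip 0 \<le> 1"
      by (simp add: hnorm_def)
    then show "{sqrt (norm (colsq (length ys) (\<lambda>i. ip (ys ! i) z))) |z. hnorm ip z \<le> 1} \<noteq> {}"
      by blast
  next
    fix s assume "s \<in> {sqrt (norm (colsq (length ys) (\<lambda>i. ip (ys ! i) z))) |z. hnorm ip z \<le> 1}"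
    then obtain z where s: "s = sqrt (norm (colsq (length ys) (\<lambda>i. ip (ys ! i) z)))"
      and "hnorm ip z \<le> 1"
      by blast
    from this(2) have "norm (ip z z) \<le> 1" by (simp add: hnorm_def)
    with adm show "s \<le> 1"
      unfolding s admissible_def by (meson order_trans real_sqrt_le_1_iff)
  qed
qed

lemma star_norm_set_altdef:
  "star_norm_set st ip xs =
    {sqrt (norm (pairing ys xs)) |ys. length ys = length xs \<and> admissible ys}"
  unfolding star_norm_set_def cabsA_square mu_star_le_1 colsq_def[symmetric] ..

lemma norm_pairing_le:
  assumes "length ys = length xs" "admissible ys"
  shows "norm (pairing ys xs) \<le> (\<Sum>i<length xs. norm (ip (xs ! i) (xs ! i)))"
  using assms by (intro order_trans[OF norm_colsq_le] sum_mono admissibleD) auto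

text \<open>Each entry of an admissible family is contractive by itself. Boundedness makes
  \<open>star_norm\<close> a genuine supremum.\<close>

lemma bdd_above_star_norm_set: "bdd_above (star_norm_set st ip xs)"
  unfolding star_norm_set_altdef
  by (rule bdd_aboveI[of _ "sqrt (\<Sum>i<length xs. norm (ip (xs ! i) (xs ! i)))"])
    (auto intro: norm_pairing_le)

lemma admissible_zeros: "admissible (replicate n 0)"
  by (simp add: admissible_def colsq_def)

lemma star_norm_leI:
  assumes "\<And>ys. length ys = length xs \<Longrightarrow> admissible ys \<Longrightarrow> sqrt (norm (pairing ys xs)) \<le> B"
  shows "star_norm st ip n xs \<le> B"
  unfolding star_norm_def
proof (rule cSup_least)
  show "star_norm_set st ip xs \<noteq> {}"
    unfolding star_norm_set_altdef using admissible_zeros[of "length xs"] by force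
qed (use assms in \<open>auto simp: star_norm_set_altdef\<close>)

lemma star_norm_geI:
  assumes "length ys = length xs" "admissible ys"
  shows "sqrt (norm (pairing ys xs)) \<le> star_norm st ip n xs"
  unfolding star_norm_def
  by (rule cSup_upper[OF _ bdd_above_star_norm_set]) (use assms in \<open>auto simp: star_norm_set_altdef\<close>)

lemma star_norm_nonneg: "0 \<le> star_norm st ip n xs"
  using star_norm_geI[of "replicate (length xs) 0" xs n] admissible_zeros
  by (force intro: order_trans[rotated])

text \<open>The normalized vector \<open>x\<^sub>i / \<parallel>x\<^sub>i\<parallel>\<close> in slot \<open>i\<close> and zero elsewhere is admissible.\<close>

lemma hnorm_le_star_norm:
  assumes "i < length xs" shows "hnorm ip (xs ! i) \<le> star_norm st ip n xs"
proof (cases "xs ! i = 0")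
  case True
  then show ?thesis
    by (simp add: star_norm_nonneg hnorm_def)
next
  case False
  let ?x = "xs ! i"
  define r where "r = hnorm ip ?x"
  have r: "r > 0"
    using False by (simp add: r_def hnorm_pos)
  define y where "y = scX (complex_of_real (1 / r)) ?x"
  define ys where "ys = (replicate (length xs) 0)[i := y]"
  have single: "colsq (length xs) (\<lambda>j. ip (ys ! j) (f j)) = st (ip y (f i)) * ip y (f i)" for f
  proof -
    have "colsq (length xs) (\<lambda>j. ip (ys ! j) (f j)) =
        (\<Sum>j<length xs. if j = i then st (ip y (f i)) * ip y (f i) else 0)"
      unfolding colsq_def using assms by (intro sum.cong) (auto simp: ys_def nth_list_update)
    then show ?thesis using assms by simp
  qed
  have "hnorm ip y = 1"
    unfolding y_def hnorm_scX using r by (simp add: norm_divide r_def)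
  then have y: "norm (ip y y) = 1" by (simp add: hnorm_def)
  have "admissible ys"
    unfolding admissible_def
  proof
    fix z
    have "length ys = length xs" by (simp add: ys_def)
    then show "norm (colsq (length ys) (\<lambda>i. ip (ys ! i) z)) \<le> norm (ip z z)"
      using single[of "\<lambda>_. z"] norm_ip[of y z] y by (simp add: norm_st_mult)
  qed
  then have "sqrt (norm (pairing ys xs)) \<le> star_norm st ip n xs"
    by (intro star_norm_geI) (simp add: ys_def)
  moreover have "norm (ip y ?x) = r"
    using r by (simp add: y_def hnorm_square[symmetric] r_def norm_divide power2_eq_square)
  ultimately show ?thesis
    using r by (simp add: single norm_st_mult r_def)
qed

section \<open>Norm axioms, (A2) and the case n = 1\<close>

lemma star_norm_eq_0:
  assumes "length xs = n" shows "star_norm st ip n xs = 0 \<longleftrightarrow> xs = replicate n 0"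
proof
  assume "star_norm st ip n xs = 0"
  then have "xs ! i = 0" if "i < n" for i
    using hnorm_le_star_norm[of i xs n] that assms hnorm_nonneg[of "xs ! i"] hnorm_eq_0 by force
  then show "xs = replicate n 0"
    using assms by (intro nth_equalityI) auto
next
  assume xs: "xs = replicate n 0"
  have "star_norm st ip n xs \<le> 0"
    by (rule star_norm_leI) (simp add: xs colsq_def)
  then show "star_norm st ip n xs = 0"
    using star_norm_nonneg[of n xs] by simp
qed

lemma star_norm_triangle:
  assumes "length xs = n" "length ys = n"
  shows "star_norm st ip n (map2 (+) xs ys) \<le> star_norm st ip n xs + star_norm st ip n ys"
proof (rule star_norm_leI)
  fix vs assume vs: "length vs = length (map2 (+) xs ys)" "admissible vs"
  have "pairing vs (map2 (+) xs ys) = colsq n (\<lambda>i. ip (vs ! i) (xs ! i) + ip (vs ! i) (ys ! i))"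
    using assms by (auto intro: colsq_cong)
  then have "sqrt (norm (pairing vs (map2 (+) xs ys))) \<le>
      sqrt (norm (pairing vs xs)) + sqrt (norm (pairing vs ys))"
    using norm_colsq_add assms by simp
  also have "\<dots> \<le> star_norm st ip n xs + star_norm st ip n ys"
    using vs assms by (intro add_mono star_norm_geI) auto
  finally show "sqrt (norm (pairing vs (map2 (+) xs ys))) \<le>
      star_norm st ip n xs + star_norm st ip n ys" .
qed

lemma cpos_square_scale:
  assumes "cmod c \<le> K" shows "cpos st (st (K *\<^sub>R a) * (K *\<^sub>R a) - st (scA c a) * scA c a)"
proof -
  have "cnj c * c = complex_of_real ((cmod c)\<^sup>2)"
    by (metis complex_norm_square mult.commute of_real_power)
  then have "st (scA c a) * scA c a = (cmod c)\<^sup>2 *\<^sub>R (st a * a)"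
    by (metis st_scA scA_mult_left scA_mult_right scA_scA scA_real)
  then have "st (K *\<^sub>R a) * (K *\<^sub>R a) - st (scA c a) * scA c a = (K\<^sup>2 - (cmod c)\<^sup>2) *\<^sub>R (st a * a)"
    by (simp add: power2_eq_square scaleR_left_diff_distrib)
  moreover have "(cmod c)\<^sup>2 \<le> K\<^sup>2"
    using assms by (intro power_mono) auto
  ultimately show ?thesis
    by (simp add: cpos_scaleR)
qed

lemma star_norm_scale_le:
  assumes "length xs = n" "length cs = n" "\<And>i. i < n \<Longrightarrow> cmod (cs ! i) \<le> K" "0 \<le> K"
  shows "star_norm st ip n (map2 scX cs xs) \<le> K * star_norm st ip n xs"
proof (rule star_norm_leI)
  fix ys assume ys: "length ys = length (map2 scX cs xs)" "admissible ys"
  have "norm (pairing ys (map2 scX cs xs)) = norm (colsq n (\<lambda>i. scA (cs ! i) (ip (ys ! i) (xs ! i))))"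
    using assms by (auto intro!: arg_cong[of _ _ norm] colsq_cong)
  also have "\<dots> \<le> norm (colsq n (\<lambda>i. K *\<^sub>R ip (ys ! i) (xs ! i)))"
    by (intro colsq_mono cpos_square_scale assms)
  also have "colsq n (\<lambda>i. K *\<^sub>R ip (ys ! i) (xs ! i)) = K\<^sup>2 *\<^sub>R pairing ys xs"
    using assms(1) by (simp add: colsq_def scaleR_sum_right power2_eq_square)
  finally have "norm (pairing ys (map2 scX cs xs)) \<le> K\<^sup>2 * norm (pairing ys xs)"
    unfolding norm_scaleR by simp
  from real_sqrt_le_mono[OF this]
  have "sqrt (norm (pairing ys (map2 scX cs xs))) \<le> K * sqrt (norm (pairing ys xs))"
    using assms(4) by (simp only: real_sqrt_mult real_sqrt_abs abs_of_nonneg)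
  also have "\<dots> \<le> K * star_norm st ip n xs"
    using ys assms by (intro mult_left_mono star_norm_geI) auto
  finally show "sqrt (norm (pairing ys (map2 scX cs xs))) \<le> K * star_norm st ip n xs" .
qed

text \<open>The preceding inequality, applied to \<open>c\<close> and to
  \<open>inverse c\<close>.\<close>

lemma star_norm_scale:
  assumes "length xs = n" shows "star_norm st ip n (map (scX c) xs) = cmod c * star_norm st ip n xs"
proof -
  have *: "star_norm st ip n (map (scX d) vs) \<le> cmod d * star_norm st ip n vs" if "length vs = n" for d vs
  proof -
    have "map (scX d) vs = map2 scX (replicate n d) vs"
      using that by (intro nth_equalityI) auto
    then show ?thesis
      using star_norm_scale_le[of vs n "replicate n d" "cmod d"] that by simp
  qed
  show ?thesis
  proof (cases "c = 0")
    case True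
    with *[OF assms, of c] star_norm_nonneg[of n "map (scX c) xs"] show ?thesis by simp
  next
    case False
    have "map (scX (inverse c)) (map (scX c) xs) = xs"
      using False by (simp add: o_def flip: scX_mult)
    with *[of "map (scX c) xs" "inverse c"] assms
    have "star_norm st ip n xs \<le> inverse (cmod c) * star_norm st ip n (map (scX c) xs)"
      by (simp add: norm_inverse)
    then have "cmod c * star_norm st ip n xs \<le> star_norm st ip n (map (scX c) xs)"
      using False by (simp add: field_simps)
    with *[OF assms, of c] show ?thesis by simp
  qed
qed

lemma is_norm_on_star_norm: "is_norm_on scX n (star_norm st ip n)"
  unfolding is_norm_on_def
  using star_norm_nonneg star_norm_eq_0 star_norm_triangle star_norm_scale by blast

lemma star_norm_single: "star_norm st ip 1 [x] = hnorm ip x"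
proof (rule antisym)
  show "star_norm st ip 1 [x] \<le> hnorm ip x"
    by (rule star_norm_leI) (use norm_pairing_le[of _ "[x]"] in \<open>simp add: hnorm_def\<close>)
  show "hnorm ip x \<le> star_norm st ip 1 [x]"
    using hnorm_le_star_norm[of 0 "[x]" 1] by simp
qed

section \<open>(A1): permutations\<close>

lemma colsq_permute: "\<sigma> permutes {..<n} \<Longrightarrow> colsq n (\<lambda>i. f (\<sigma> i)) = colsq n f"
  unfolding colsq_def using sum.permute[of \<sigma> "{..<n}" "\<lambda>i. st (f i) * f i"] by (simp add: o_def)

text \<open>Permuting the functionals by \<open>inv \<sigma>\<close> has the same effect as
  permuting the vectors by \<open>\<sigma>\<close>, and it keeps the family admissible.\<close>

lemma star_norm_permute_le:
  assumes "length xs = n" "\<sigma> permutes {..<n}"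
  shows "star_norm st ip n (map (\<lambda>i. xs ! \<sigma> i) [0..<n]) \<le> star_norm st ip n xs"
proof (rule star_norm_leI)
  let ?xs = "map (\<lambda>i. xs ! \<sigma> i) [0..<n]"
  fix ys assume ys: "length ys = length ?xs" "admissible ys"
  let ?ys = "map (\<lambda>i. ys ! inv \<sigma> i) [0..<n]"
  have inv: "inv \<sigma> permutes {..<n}"
    using assms(2) by (rule permutes_inv)
  have len: "length ys = n" using ys(1) by simp
  have "colsq n (\<lambda>i. ip (?ys ! i) z) = colsq n (\<lambda>i. ip (ys ! i) z)" for z
  proof -
    have "colsq n (\<lambda>i. ip (?ys ! i) z) = colsq n (\<lambda>i. ip (ys ! inv \<sigma> i) z)"
      by (rule colsq_cong) simp
    then show ?thesis
      using colsq_permute[OF inv, of "\<lambda>i. ip (ys ! i) z"] by simp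
  qed
  then have "admissible ?ys"
    using ys(2) len by (simp add: admissible_def)
  moreover have "pairing ys ?xs = pairing ?ys xs"
  proof -
    have "pairing ?ys xs = colsq n (\<lambda>i. ip (ys ! inv \<sigma> i) (xs ! i))"
      unfolding assms(1) by (rule colsq_cong) simp
    also have "\<dots> = colsq n (\<lambda>i. ip (ys ! inv \<sigma> (\<sigma> i)) (xs ! \<sigma> i))"
      by (rule colsq_permute[OF assms(2), symmetric])
    also have "\<dots> = colsq n (\<lambda>i. ip (ys ! i) (?xs ! i))"
      by (rule colsq_cong) (simp add: permutes_inverses[OF assms(2)])
    finally show ?thesis by simp
  qed
  ultimately show "sqrt (norm (pairing ys ?xs)) \<le> star_norm st ip n xs"
    using star_norm_geI[of ?ys xs n] assms(1) by simp
qed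

lemma star_norm_permute:
  assumes "length xs = n" "\<sigma> permutes {..<n}"
  shows "star_norm st ip n (map (\<lambda>i. xs ! \<sigma> i) [0..<n]) = star_norm st ip n xs"
proof (rule antisym[OF star_norm_permute_le[OF assms]])
  let ?xs = "map (\<lambda>i. xs ! \<sigma> i) [0..<n]"
  have inv: "inv \<sigma> permutes {..<n}"
    using assms(2) by (rule permutes_inv)
  have "map (\<lambda>i. ?xs ! inv \<sigma> i) [0..<n] = xs"
  proof (rule nth_equalityI)
    fix i assume "i < length (map (\<lambda>i. ?xs ! inv \<sigma> i) [0..<n])"
    then have "i < n" by simp
    then have "inv \<sigma> i < n"
      using permutes_in_image[OF inv, of i] by simp
    with \<open>i < n\<close> show "map (\<lambda>i. ?xs ! inv \<sigma> i) [0..<n] ! i = xs ! i"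
      by (simp add: permutes_inverses[OF assms(2)])
  qed (simp add: assms)
  then show "star_norm st ip n xs \<le> star_norm st ip n ?xs"
    using star_norm_permute_le[of ?xs n "inv \<sigma>"] inv by simp
qed

section \<open>(A3) and (A4): appending an entry\<close>

lemma colsq_append:
  assumes "length ys = n"
  shows "colsq (Suc n) (\<lambda>i. ip ((ys @ [y]) ! i) (f i)) =
    colsq n (\<lambda>i. ip (ys ! i) (f i)) + st (ip y (f n)) * ip y (f n)"
proof -
  have "colsq n (\<lambda>i. ip ((ys @ [y]) ! i) (f i)) = colsq n (\<lambda>i. ip (ys ! i) (f i))"
    using assms by (intro colsq_cong) (simp add: nth_append)
  with assms show ?thesis by (simp add: nth_append)
qed

lemma admissible_append_iff:
  "admissible (ys @ [y]) \<longleftrightarrow>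
    (\<forall>z. norm (colsq (length ys) (\<lambda>i. ip (ys ! i) z) + st (ip y z) * ip y z) \<le> norm (ip z z))"
  unfolding admissible_def using colsq_append[OF refl, of ys y "\<lambda>_. _"] by simp

lemma pairing_append:
  assumes "length ys = length xs"
  shows "pairing (ys @ [y]) (xs @ [x]) = pairing ys xs + st (ip y x) * ip y x"
proof -
  have "pairing (ys @ [y]) (xs @ [x]) = colsq (Suc (length xs)) (\<lambda>i. ip ((ys @ [y]) ! i) ((xs @ [x]) ! i))"
    by simp
  also have "\<dots> = colsq (length xs) (\<lambda>i. ip (ys ! i) ((xs @ [x]) ! i)) + st (ip y x) * ip y x"
    unfolding colsq_append[OF assms] by simp
  also have "colsq (length xs) (\<lambda>i. ip (ys ! i) ((xs @ [x]) ! i)) = pairing ys xs"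
    by (rule colsq_cong) (simp add: nth_append)
  finally show ?thesis .
qed

lemma length_SucE:
  assumes "length ys = Suc n" obtains zs z where "ys = zs @ [z]" "length zs = n"
  using assms by (metis length_Suc_conv_rev)

lemma admissible_appendD: assumes "admissible (ys @ [y])" shows "admissible ys"
  unfolding admissible_def
proof
  fix z
  have "norm (colsq (length ys) (\<lambda>i. ip (ys ! i) z)) \<le>
      norm (colsq (length ys) (\<lambda>i. ip (ys ! i) z) + st (ip y z) * ip y z)"
    by (rule cpos_norm_mono) auto
  with assms show "norm (colsq (length ys) (\<lambda>i. ip (ys ! i) z)) \<le> norm (ip z z)"
    unfolding admissible_append_iff by (meson order_trans)
qed

text \<open>One direction drops the last functional, the other appends the functional 0.\<close>

lemma star_norm_append_zero:
  assumes "length xs = n" shows "star_norm st ip (Suc n) (xs @ [0]) = star_norm st ip n xs"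
proof (rule antisym)
  show "star_norm st ip (Suc n) (xs @ [0]) \<le> star_norm st ip n xs"
  proof (rule star_norm_leI)
    fix ys assume ys: "length ys = length (xs @ [0])" "admissible ys"
    then have "length ys = Suc n" using assms by simp
    then obtain zs z where z: "ys = zs @ [z]" "length zs = n" by (rule length_SucE)
    with ys(2) assms show "sqrt (norm (pairing ys (xs @ [0]))) \<le> star_norm st ip n xs"
      using star_norm_geI[of zs xs n] admissible_appendD[of zs z] pairing_append[of zs xs 0 z]
      by (simp del: colsq_simps)
  qed
  show "star_norm st ip n xs \<le> star_norm st ip (Suc n) (xs @ [0])"
  proof (rule star_norm_leI)
    fix ys assume ys: "length ys = length xs" "admissible ys"
    then have "admissible (ys @ [0])"
      unfolding admissible_append_iff by (simp add: admissible_def)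
    with ys(1) show "sqrt (norm (pairing ys xs)) \<le> star_norm st ip (Suc n) (xs @ [0])"
      using star_norm_geI[of "ys @ [0]" "xs @ [0]" "Suc n"] pairing_append[of ys xs 0 0]
      by (simp del: colsq_simps)
  qed
qed

text \<open>The last two functionals \<open>y\<close>, \<open>y'\<close> are replaced by the single \<open>y a + y' b\<close>, where \<open>(a, b)\<close> is
  the approximate polar part of the column \<open>(\<langle>y, x\<rangle>, \<langle>y', x\<rangle>)\<close>. Contractivity of \<open>(a, b)\<close> keeps the
  family admissible and \<open>|\<langle>y a + y' b, x\<rangle>|\<^sup>2\<close> approximates \<open>|\<langle>y, x\<rangle>|\<^sup>2 + |\<langle>y', x\<rangle>|\<^sup>2\<close>.\<close>

lemma star_norm_append_last:
  assumes "length xs = n" "n \<ge> 1"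
  shows "star_norm st ip (Suc n) (xs @ [last xs]) \<le> star_norm st ip n xs"
proof (rule star_norm_leI)
  fix vs assume vs: "length vs = length (xs @ [last xs])" "admissible vs"
  \<comment> \<open>\<open>n \<ge> 1\<close> gives \<open>xs\<close> a last entry and
    \<open>vs\<close> at least two entries, to be merged.\<close>
  obtain k where k: "n = Suc k" using assms(2) by (cases n) auto
  obtain ws x where xs: "xs = ws @ [x]" "length ws = k"
    using assms(1) unfolding k by (rule length_SucE)
  obtain us y' where "vs = us @ [y']" "length us = n"
    using vs(1) assms(1) by (auto elim: length_SucE)
  moreover from this obtain ys y where "us = ys @ [y]" "length ys = k"
    unfolding k by (blast elim: length_SucE)
  ultimately have vs_eq: "vs = (ys @ [y]) @ [y']" and len: "length ys = length ws"
    using xs(2) by auto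
  let ?sq = "\<lambda>a :: 'a. st a * a"
  have split: "pairing vs (xs @ [last xs]) = pairing ys ws + (?sq (ip y x) + ?sq (ip y' x))"
    using len unfolding vs_eq xs(1)
    by (subst pairing_append, simp, subst pairing_append) (simp_all add: add.assoc)
  have "norm (pairing vs (xs @ [last xs])) \<le> (star_norm st ip n xs)\<^sup>2 + \<epsilon>" if "\<epsilon> > 0" for \<epsilon>
  proof -
    obtain a b where ab: "norm (?sq a + ?sq b) \<le> 1"
      "norm ((?sq (ip y x) + ?sq (ip y' x)) - ?sq (st a * ip y x + st b * ip y' x)) \<le> \<epsilon>"
      using approx_polar[OF \<open>\<epsilon> > 0\<close>] by blast
    define u where "u = act y a + act y' b"
    have u: "ip u z = st a * ip y z + st b * ip y' z" for z
      by (simp add: u_def)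
    have "admissible (ys @ [u])"
      unfolding admissible_append_iff
    proof
      fix z
      let ?c = "colsq (length ys) (\<lambda>i. ip (ys ! i) z)"
      \<comment> \<open>The column \<open>(ip y z, ip y' z)\<close> against the contraction
        \<open>(a, b)\<close>:
        \<open>|ip u z|\<^sup>2 \<le> |ip y z|\<^sup>2 + |ip y' z|\<^sup>2\<close>.\<close>
      have "cpos st (colsq 2 (\<lambda>i. if i = 0 then ip y z else ip y' z) - ?sq (ip u z))"
        by (rule colsq_contraction[of 2 "\<lambda>i. if i = 0 then a else b"])
          (use ab(1) in \<open>simp_all add: numeral_2_eq_2 u\<close>)
      then have "cpos st ((?c + ?sq (ip y z) + ?sq (ip y' z)) - (?c + ?sq (ip u z)))"
        by (simp add: numeral_2_eq_2 algebra_simps)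
      from cpos_norm_mono[OF _ this]
      have "norm (?c + ?sq (ip u z)) \<le> norm (?c + ?sq (ip y z) + ?sq (ip y' z))"
        by (simp add: cpos_add)
      also have "\<dots> \<le> norm (ip z z)"
        using vs(2)[unfolded vs_eq admissible_append_iff, rule_format, of z]
          colsq_append[OF refl, of ys y "\<lambda>_. z"] by (simp del: colsq_simps)
      finally show "norm (?c + ?sq (ip u z)) \<le> norm (ip z z)" .
    qed
    then have "sqrt (norm (pairing (ys @ [u]) xs)) \<le> star_norm st ip n xs"
      by (rule star_norm_geI[rotated]) (simp add: xs len)
    then have "norm (pairing (ys @ [u]) xs) \<le> (star_norm st ip n xs)\<^sup>2"
      by (rule sqrt_le_D)
    then have *: "norm (pairing ys ws + ?sq (ip u x)) \<le> (star_norm st ip n xs)\<^sup>2"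
      using pairing_append[OF len, of x u] xs(1) by simp
    have "pairing vs (xs @ [last xs]) = (pairing ys ws + ?sq (ip u x)) +
        ((?sq (ip y x) + ?sq (ip y' x)) - ?sq (ip u x))"
      unfolding split by (simp add: algebra_simps)
    with norm_triangle_mono[OF * ab(2)[folded u]] show ?thesis
      by (simp only:)
  qed
  then have "norm (pairing vs (xs @ [last xs])) \<le> (star_norm st ip n xs)\<^sup>2"
    by (rule field_le_epsilon)
  then show "sqrt (norm (pairing vs (xs @ [last xs]))) \<le> star_norm st ip n xs"
    by (rule real_le_lsqrt[OF star_norm_nonneg])
qed

lemma multi_norm_star_norm: "multi_norm scX (hnorm ip) (star_norm st ip)"
  unfolding multi_norm_def
proof (intro conjI allI impI)
  fix n and x :: "'x list" and \<alpha> :: "complex list"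
  assume n: "1 \<le> n" and len: "length x = n \<and> length \<alpha> = n"
  have le: "cmod (\<alpha> ! i) \<le> Max (cmod ` set \<alpha>)" if "i < n" for i
    using that len by (intro Max_ge) auto
  moreover have "0 \<le> Max (cmod ` set \<alpha>)"
    by (rule order_trans[OF norm_ge_zero le[of 0]]) (use n in simp)
  ultimately show "star_norm st ip n (map2 scX \<alpha> x) \<le> Max (cmod ` set \<alpha>) * star_norm st ip n x"
    using len by (intro star_norm_scale_le) auto
qed (use is_norm_on_star_norm star_norm_single star_norm_permute star_norm_append_zero
    star_norm_append_last in auto)

end

theorem mainTheorem1:
  fixes scA :: "complex \<Rightarrow> 'a::{banach, real_normed_algebra} \<Rightarrow> 'a"
    and st :: "'a \<Rightarrow> 'a"
    and scX :: "complex \<Rightarrow> 'x::ab_group_add \<Rightarrow> 'x"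
    and act :: "'x \<Rightarrow> 'a \<Rightarrow> 'x"
    and ip :: "'x \<Rightarrow> 'x \<Rightarrow> 'a"
  assumes "hilbert_module scA st scX act ip"
  shows "(\<forall>xs::'x list. xs \<noteq> [] \<longrightarrow> bdd_above (star_norm_set st ip xs))
       \<and> multi_norm scX (hnorm ip) (star_norm st ip)"
proof -
  interpret hilbert_mod scA st scX act ip
    using assms by unfold_locales
  show ?thesis
    by (simp add: bdd_above_star_norm_set multi_norm_star_norm)
qed

end
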